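(* Suppose $\beta>1$ and $\mathbb{E}[\eta_0]<\infty$. Then, as $n\to\infty$, the process $(X_{nt}/n)_{t\ge0}$ converges $\mathbb{P}$-a.s. on $D([0,\infty),\mathbb{R})$ endowed with the Skorohod metric to the process $(\nu t)_{t\ge0}$, uniformly over $t$ in compact sets, where $$\nu=\frac{\beta-1}{\mathbb{E}[\eta_0](\beta+1)}.$$
   Context: Randomly trapped random walk on $\mathbb{Z}$. Let $Y_0=0$ and $Y_k=\sum_{j=1}^k\chi_j$, where $(\chi_j)_{j\ge1}$ are i.i.d. with $P(\chi_j=-1)=(\beta+1)^{-1}=1-P(\chi_j=1)$. Let $L(x,n)=\sum_{k=0}^n\mathbf{1}_{\{Y_k=x\}}$ for $x\in\mathbb{Z}$. A random environment is a sequence $\omega=(\omega_x)_{x\in\mathbb{Z}}$ of probability measures on $(0,\infty)$ with law $\mathbf{P}=\pi^{\otimes\mathbb{Z}}$, i.e. the $\omega_x$ are i.i.d. with a fixed law $\pi$ (a law on probability measures on $(0,\infty)$). Given $\omega$, let $(\eta_{x,i})_{x\in\mathbb{Z},i\ge0}$ be independent random variables with $\eta_{x,i}\sim\omega_x$, independent of $Y$. Put $\eta_k=\eta_{Y_k,L(Y_k,k)}$ for $k\ge0$ (the $k$-th holding time), $S_n=\sum_{k=0}^{n-1}\eta_k$, $S^{-1}_t=\max\{k\ge0:S_k\le t\}$ and $X_t=Y_{S^{-1}_t}$ for real $t\ge0$. $P^\omega$ denotes the law for fixed $\omega$ and $\mathbb{P}(\cdot)=\int P^\omega(\cdot)\,\mathbf{P}(d\omega)$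 the annealed law, with expectation $\mathbb{E}$. *)

theory Defs
  imports "HOL-Probability.Probability"
begin

section \<open>The biased walk and the trap model, as functions of the realised randomness\<close>

text \<open>
  A realisation is a pair consisting of a step sequence \<open>\<xi>\<close> (used at indices \<open>j \<ge> 1\<close>) and an array
  \<open>\<eta>\<close> of waiting times indexed by a site and a visit number.
\<close>

definition walk :: "(nat \<Rightarrow> int) \<Rightarrow> nat \<Rightarrow> int" where
  "walk \<xi> k = (\<Sum>j=1..k. \<xi> j)"

definition local_time :: "(nat \<Rightarrow> int) \<Rightarrow> int \<Rightarrow> nat \<Rightarrow> nat" where
  "local_time \<xi> x n = card {k. k \<le> n \<and> walk \<xi> k = x}"

definition holding :: "(nat \<Rightarrow> int) \<Rightarrow> (int \<times> nat \<Rightarrow> real) \<Rightarrow> nat \<Rightarrow> real" where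
  "holding \<xi> \<eta> k = \<eta> (walk \<xi> k, local_time \<xi> (walk \<xi> k) k)"

definition clock :: "(nat \<Rightarrow> int) \<Rightarrow> (int \<times> nat \<Rightarrow> real) \<Rightarrow> nat \<Rightarrow> real" where
  "clock \<xi> \<eta> n = (\<Sum>k<n. holding \<xi> \<eta> k)"

text \<open>
  \<open>Max\<close> is unspecified on infinite sets, so \<open>clock_inverse\<close> carries no information for
  realisations whose clock stays bounded.
\<close>

definition clock_inverse :: "(nat \<Rightarrow> int) \<Rightarrow> (int \<times> nat \<Rightarrow> real) \<Rightarrow> real \<Rightarrow> nat" where
  "clock_inverse \<xi> \<eta> t = Max {k. clock \<xi> \<eta> k \<le> t}"

definition trapped_walk :: "(nat \<Rightarrow> int) \<Rightarrow> (int \<times> nat \<Rightarrow> real) \<Rightarrow> real \<Rightarrow> int" where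
  "trapped_walk \<xi> \<eta> t = walk \<xi> (clock_inverse \<xi> \<eta> t)"

section \<open>Environment, quenched law and annealed law\<close>

definition step_pmf :: "real \<Rightarrow> int pmf" where
  "step_pmf \<beta> = map_pmf (\<lambda>left. if left then -1 else 1) (bernoulli_pmf (1 / (\<beta> + 1)))"

definition pos_real :: "real measure" where
  "pos_real = restrict_space borel {0<..}"

definition step_law :: "real \<Rightarrow> (nat \<Rightarrow> int) measure" where
  "step_law \<beta> = PiM {1..} (\<lambda>_. measure_pmf (step_pmf \<beta>))"

definition trap_law :: "(int \<Rightarrow> real measure) \<Rightarrow> (int \<times> nat \<Rightarrow> real) measure" where
  "trap_law \<omega> = PiM UNIV (\<lambda>(x, i). \<omega> x)"

definition environment_law :: "real measure measure \<Rightarrow> (int \<Rightarrow> real measure) measure" where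
  "environment_law \<pi> = PiM UNIV (\<lambda>_. \<pi>)"

definition quenched_law ::
    "real \<Rightarrow> (int \<Rightarrow> real measure) \<Rightarrow> ((nat \<Rightarrow> int) \<times> (int \<times> nat \<Rightarrow> real)) measure" where
  "quenched_law \<beta> \<omega> = step_law \<beta> \<Otimes>\<^sub>M trap_law \<omega>"

definition annealed_law ::
    "real \<Rightarrow> real measure measure \<Rightarrow> ((nat \<Rightarrow> int) \<times> (int \<times> nat \<Rightarrow> real)) measure" where
  "annealed_law \<beta> \<pi> = environment_law \<pi> \<bind> quenched_law \<beta>"

definition speed :: "real \<Rightarrow> real measure measure \<Rightarrow> real" where
  "speed \<beta> \<pi> =
     (\<beta> - 1) / ((\<integral>(\<xi>, \<eta>). holding \<xi> \<eta> 0 \<partial>annealed_law \<beta> \<pi>) * (\<beta> + 1))"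

text \<open>
  \<open>bind\<close> is meaningful only for a measurable kernel; the lemmas below establish this and the
  mixture formula for the annealed law.
\<close>

lemma prob_space_step_law: "prob_space (step_law \<beta>)"
  unfolding step_law_def by (intro prob_space_PiM prob_space_measure_pmf)

lemma measurable_trap_law:
  assumes "\<pi> \<in> space (prob_algebra (prob_algebra pos_real))"
  shows "trap_law \<in> environment_law \<pi> \<rightarrow>\<^sub>M prob_algebra (PiM UNIV (\<lambda>_. pos_real))"
proof (rule measurable_prob_algebra_generated[OF sets_PiM Int_stable_prod_algebra
      prod_algebra_sets_into_space])
  have sets_pi: "sets \<pi> = sets (prob_algebra pos_real)"
    using assms by (simp add: space_prob_algebra)
  have mem: "\<omega> x \<in> space (prob_algebra pos_real)" if "\<omega> \<in> space (environment_law \<pi>)" for \<omega> x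
    using that sets_eq_imp_space_eq[OF sets_pi] by (auto simp: environment_law_def space_PiM)
  show "prob_space (trap_law \<omega>)" if "\<omega> \<in> space (environment_law \<pi>)" for \<omega>
    using mem[OF that] unfolding trap_law_def
    by (intro prob_space_PiM) (auto simp: space_prob_algebra split: prod.splits)
  show sets_trap: "sets (trap_law \<omega>) = sets (PiM UNIV (\<lambda>_. pos_real))"
    if "\<omega> \<in> space (environment_law \<pi>)" for \<omega>
    using mem[OF that] unfolding trap_law_def
    by (intro sets_PiM_cong) (auto simp: space_prob_algebra split: prod.splits)
  fix A :: "(int \<times> nat \<Rightarrow> real) set"
  assume "A \<in> prod_algebra UNIV (\<lambda>_. pos_real)"
  then obtain J E where A: "A = prod_emb UNIV (\<lambda>_. pos_real) J (Pi\<^sub>E J E)" and J: "finite J"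
    and E: "\<And>i. i \<in> J \<Longrightarrow> E i \<in> sets pos_real"
    by (rule prod_algebraE) auto
  have eq: "emeasure (trap_law \<omega>) A = (\<Prod>i\<in>J. emeasure (\<omega> (fst i)) (E i))"
    if "\<omega> \<in> space (environment_law \<pi>)" for \<omega>
  proof -
    have s: "sets (\<omega> x) = sets pos_real" and p: "prob_space (\<omega> x)" for x
      using mem[OF that, of x] by (auto simp: space_prob_algebra)
    have "A = prod_emb UNIV (\<lambda>i. \<omega> (fst i)) J (Pi\<^sub>E J E)"
      unfolding A prod_emb_def using sets_eq_imp_space_eq[OF s] by simp
    moreover have "trap_law \<omega> = PiM UNIV (\<lambda>i. \<omega> (fst i))"
      unfolding trap_law_def by (simp add: case_prod_beta')
    ultimately show ?thesis
      using emeasure_PiM_emb[of UNIV "\<lambda>i. \<omega> (fst i)" J E] J E p s by simp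
  qed
  have comp: "(\<lambda>\<omega>. \<omega> x) \<in> environment_law \<pi> \<rightarrow>\<^sub>M subprob_algebra pos_real" for x
  proof -
    have "(\<lambda>\<omega>. \<omega> x) \<in> environment_law \<pi> \<rightarrow>\<^sub>M prob_algebra pos_real"
      unfolding environment_law_def
      using measurable_component_singleton[of x UNIV "\<lambda>_. \<pi>"]
        measurable_cong_sets[OF refl sets_pi] by blast
    then show ?thesis by (rule measurable_prob_algebraD)
  qed
  have "(\<lambda>\<omega>. \<Prod>i\<in>J. emeasure (\<omega> (fst i)) (E i)) \<in> borel_measurable (environment_law \<pi>)"
    by (intro borel_measurable_prod_ennreal measurable_emeasure_kernel[OF comp] E)
  then show "(\<lambda>\<omega>. emeasure (trap_law \<omega>) A) \<in> borel_measurable (environment_law \<pi>)"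
    using eq by (simp cong: measurable_cong)
qed

lemma measurable_quenched_law:
  assumes "\<pi> \<in> space (prob_algebra (prob_algebra pos_real))"
  shows "quenched_law \<beta> \<in> environment_law \<pi> \<rightarrow>\<^sub>M
           prob_algebra (step_law \<beta> \<Otimes>\<^sub>M PiM UNIV (\<lambda>_. pos_real))"
proof -
  have "(\<lambda>_. step_law \<beta>) \<in> environment_law \<pi> \<rightarrow>\<^sub>M prob_algebra (step_law \<beta>)"
    by (intro measurable_const) (simp add: space_prob_algebra prob_space_step_law)
  from measurable_pair_prob[OF this measurable_trap_law[OF assms]] show ?thesis
    unfolding quenched_law_def[abs_def] .
qed

lemma environment_law_in_prob_algebra:
  assumes "\<pi> \<in> space (prob_algebra (prob_algebra pos_real))"
  shows "environment_law \<pi> \<in> space (prob_algebra (environment_law \<pi>))"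
  using assms unfolding environment_law_def
  by (auto simp: space_prob_algebra intro!: prob_space_PiM)

lemma emeasure_annealed_law:
  assumes "\<pi> \<in> space (prob_algebra (prob_algebra pos_real))"
    and "A \<in> sets (step_law \<beta> \<Otimes>\<^sub>M PiM UNIV (\<lambda>_. pos_real))"
  shows "emeasure (annealed_law \<beta> \<pi>) A =
           (\<integral>\<^sup>+\<omega>. emeasure (quenched_law \<beta> \<omega>) A \<partial>environment_law \<pi>)"
  unfolding annealed_law_def
  by (rule emeasure_bind_prob_algebra[OF environment_law_in_prob_algebra[OF assms(1)]
        measurable_quenched_law[OF assms(1)] assms(2)])

section \<open>The Skorohod space on the half-line\<close>

text \<open>
  Paths are total functions on \<open>real\<close> of which only the values on \<open>[0, \<infinity>)\<close> matter.
\<close>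

definition skorohod_space :: "(real \<Rightarrow> real) set" where
  "skorohod_space =
     {x. (\<forall>t\<ge>0. continuous (at_right t) x) \<and> (\<forall>t>0. \<exists>l. (x \<longlongrightarrow> l) (at_left t))}"

definition time_changes :: "real \<Rightarrow> (real \<Rightarrow> real) set" where
  "time_changes m =
     {l. continuous_on {0..m} l \<and> strict_mono_on {0..m} l \<and> l ` {0..m} = {0..m}}"

definition skorohod_dist_upto :: "real \<Rightarrow> (real \<Rightarrow> real) \<Rightarrow> (real \<Rightarrow> real) \<Rightarrow> real" where
  "skorohod_dist_upto m x y =
     (INF l\<in>time_changes m.
        max (SUP t\<in>{0..m}. \<bar>l t - t\<bar>) (SUP t\<in>{0..m}. \<bar>x t - y (l t)\<bar>))"

text \<open>
  The metric on \<open>D[0, \<infinity>)\<close> is that of Billingsley (Convergence of Probability Measures, 2nd ed.,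
  Section 16): paths are tapered linearly to zero on \<open>[m - 1, m]\<close>, so that a jump near the
  cut-off \<open>m\<close> does not matter, and the distances on \<open>[0, m]\<close> are summed over \<open>m \<ge> 1\<close> with
  weights \<open>2\<^sup>-\<^sup>m\<close>. In the sum below, \<open>m\<close> is shifted by one.
\<close>

definition taper :: "real \<Rightarrow> (real \<Rightarrow> real) \<Rightarrow> real \<Rightarrow> real" where
  "taper m x t = (if t \<le> m - 1 then 1 else if t \<le> m then m - t else 0) * x t"

definition skorohod_dist :: "(real \<Rightarrow> real) \<Rightarrow> (real \<Rightarrow> real) \<Rightarrow> real" where
  "skorohod_dist x y =
     (\<Sum>m. (1 / 2) ^ Suc m *
        min 1 (skorohod_dist_upto (real (Suc m)) (taper (real (Suc m)) x) (taper (real (Suc m)) y)))"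

end

theory Submission
  imports Defs
begin

text \<open>
  The trapped walk is the biased walk read along the inverse of its clock. Suppose that a
  realisation satisfies \<open>walk n / n \<longlonglongrightarrow> v\<close> and \<open>clock n / n \<longlonglongrightarrow> \<mu>\<close> with \<open>\<mu> > 0\<close>. The clock is
  inverted by sandwiching \<open>t\<close> between two successive clock values, which gives
  \<open>t / clock_inverse t \<longrightarrow> \<mu>\<close>, and hence \<open>trapped_walk t / t \<longrightarrow> v / \<mu>\<close> as \<open>t \<longrightarrow> \<infinity>\<close>
  (\<open>trapped_walk_speed\<close>). This single limit already contains the functional statement
  (\<open>uniform_limit_of_linear_growth\<close>): after rescaling, the error at time \<open>t\<close> is a small multiple of
  \<open>t\<close> as soon as \<open>n * t\<close> is large, and for the remaining \<open>t\<close> everything is bounded by a constant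
  divided by \<open>n\<close>. The convergence is therefore uniform on compact sets, and taking the identity as
  time change turns it into convergence in the Skorohod metric (\<open>skorohod_dist_tendsto_zero\<close>).

  What remains are two laws of large numbers. The one for the clock is the substantial one: the
  holding times have only a first moment, and they are dependent, because all visits to a site share
  the random law attached to that site. Both follow from a strong law for identically distributed
  nonnegative variables (\<open>strong_law_weakly_correlated\<close>), obtained by the argument that Etemadi used
  for pairwise independent variables: truncate the \<open>k\<close>-th variable at \<open>k\<close>, bound the variance of the
  truncated sums along the geometric subsequences \<open>\<lfloor>\<alpha> ^ j\<rfloor>\<close>, and interpolate between these indices by
  monotonicity. Independence enters this argument only through the bound
  \<open>Var (\<Sum>k<n. Z k) \<le> C * (\<Sum>k<n. E (Z k)\<^sup>2)\<close>, and this bound survives if the covariance of \<open>Z k\<close> and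
  \<open>Z l\<close> is at most \<open>c (l - k) * (E (Z k)\<^sup>2 + E (Z l)\<^sup>2)\<close> with a summable \<open>c\<close>.

  For the holding times such a \<open>c\<close> comes from transience. The annealed law is the product of the law
  of the steps and an annealed law of the traps (\<open>annealed_law_eq_product\<close>), so the path can be
  frozen and the traps integrated first. If the path is at different sites at times \<open>k\<close> and \<open>l\<close>, the
  two holding times are independent; if it is at the same site, \<open>a * b \<le> a\<^sup>2 + b\<^sup>2\<close> bounds the mixed
  moment by second moments. Coincidence of the two sites has probability at most
  \<open>(2 * sqrt \<beta> / (\<beta> + 1)) ^ (l - k)\<close> by an exponential moment bound
  (\<open>return_probability_le\<close>), and the base is smaller than one because of the drift.
\<close>

section \<open>Averages along geometric subsequences\<close>

definition geometric_index :: "real \<Rightarrow> nat \<Rightarrow> nat" where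
  "geometric_index \<alpha> j = nat \<lfloor>\<alpha> ^ j\<rfloor>"

definition truncate :: "nat \<Rightarrow> real \<Rightarrow> real" where
  "truncate k x = (if x \<le> real k then x else 0)"

lemma cesaro_null:
  fixes a :: "nat \<Rightarrow> real"
  assumes "a \<longlonglongrightarrow> 0"
  shows "(\<lambda>n. (\<Sum>k<n. a k) / real n) \<longlonglongrightarrow> 0"
proof (rule LIMSEQ_I)
  fix e :: real assume e: "e > 0"
  then obtain N where N: "\<And>k. k \<ge> N \<Longrightarrow> \<bar>a k\<bar> < e / 2"
    using LIMSEQ_D[OF assms, of "e / 2"] by auto
  define C where "C = (\<Sum>k<N. \<bar>a k\<bar>)"
  have sum_le: "\<bar>\<Sum>k<n. a k\<bar> \<le> C + real n * (e / 2)" for n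
  proof (induction n)
    case 0 then show ?case by (simp add: C_def sum_nonneg)
  next
    case (Suc n)
    show ?case
    proof (cases "n < N")
      case True
      have "\<bar>\<Sum>k<Suc n. a k\<bar> \<le> (\<Sum>k<Suc n. \<bar>a k\<bar>)" by (rule sum_abs)
      also have "\<dots> \<le> C" unfolding C_def using True by (intro sum_mono2) auto
      finally show ?thesis using e by (simp add: add_increasing2)
    next
      case False
      have "\<bar>\<Sum>k<Suc n. a k\<bar> \<le> \<bar>\<Sum>k<n. a k\<bar> + \<bar>a n\<bar>" by simp
      with N[of n] Suc False show ?thesis by (simp add: algebra_simps add_divide_distrib)
    qed
  qed
  obtain M where M: "real M > 2 * C / e" using reals_Archimedean2 by blast
  have "norm ((\<Sum>k<n. a k) / real n - 0) < e" if n: "n \<ge> Suc M" for n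
  proof -
    have "2 * C / e < real n" using M n by linarith
    then have "C < real n * (e / 2)" using e by (simp add: field_simps)
    with sum_le[of n] have "\<bar>\<Sum>k<n. a k\<bar> < real n * e" by (simp add: field_simps)
    then show ?thesis using n by (simp add: field_simps)
  qed
  then show "\<exists>no. \<forall>n\<ge>no. norm ((\<Sum>k<n. a k) / real n - 0) < e" by blast
qed

lemma cesaro:
  fixes a :: "nat \<Rightarrow> real"
  assumes "a \<longlonglongrightarrow> L"
  shows "(\<lambda>n. (\<Sum>k<n. a k) / real n) \<longlonglongrightarrow> L"
proof -
  have "(\<lambda>n. (\<Sum>k<n. a k - L) / real n) \<longlonglongrightarrow> 0"
    by (rule cesaro_null) (use assms in \<open>simp add: LIM_zero_iff\<close>)
  then have "(\<lambda>n. (\<Sum>k<n. a k - L) / real n + L) \<longlonglongrightarrow> 0 + L" by (intro tendsto_intros)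
  moreover have "\<forall>\<^sub>F n in sequentially. (\<Sum>k<n. a k - L) / real n + L = (\<Sum>k<n. a k) / real n"
    using eventually_gt_at_top[of 0] by eventually_elim (simp add: sum_subtractf field_simps)
  ultimately show ?thesis using Lim_transform_eventually by fastforce
qed

lemma geometric_index_bounds:
  assumes "\<alpha> > 1"
  shows "geometric_index \<alpha> j \<ge> 1" "real (geometric_index \<alpha> j) \<le> \<alpha> ^ j"
    "\<alpha> ^ j < real (geometric_index \<alpha> j) + 1" "\<alpha> ^ j \<le> 2 * real (geometric_index \<alpha> j)"
proof -
  have one: "1 \<le> \<alpha> ^ j" using assms by simp
  then show 1: "geometric_index \<alpha> j \<ge> 1" by (simp add: geometric_index_def le_nat_iff le_floor_iff)
  have fl: "real (geometric_index \<alpha> j) = of_int \<lfloor>\<alpha> ^ j\<rfloor>"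
    using one unfolding geometric_index_def by simp
  show "real (geometric_index \<alpha> j) \<le> \<alpha> ^ j" unfolding fl by simp
  show 2: "\<alpha> ^ j < real (geometric_index \<alpha> j) + 1" unfolding fl by linarith
  show "\<alpha> ^ j \<le> 2 * real (geometric_index \<alpha> j)" using 1 2 by linarith
qed

text \<open>
  Only the powers \<open>\<alpha> ^ j \<ge> x\<close> contribute, so the sum is part of a geometric
  series whose first term is at most \<open>1 / x\<close>.
\<close>

lemma sum_inverse_powers_above_le:
  fixes \<alpha> x :: real
  assumes "\<alpha> > 1" "x > 0"
  shows "(\<Sum>j<N. if x \<le> \<alpha> ^ j then 1 / \<alpha> ^ j else 0) \<le> \<alpha> / (\<alpha> - 1) / x"
proof -
  have "(\<Sum>j<N. if x \<le> \<alpha> ^ j then 1 / \<alpha> ^ j else 0) \<le> \<alpha> / (\<alpha> - 1) * (1 / x - min (1 / x) (1 / \<alpha> ^ N))"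
  \<comment> \<open>The subtracted term makes the induction close: once \<open>\<alpha> ^ N \<ge> x\<close> it is the remaining
    tail of the geometric series, and until then it makes the bound zero.\<close>
  proof (induction N)
    case 0 then show ?case using assms by simp
  next
    case (Suc N)
    define c where "c = \<alpha> / (\<alpha> - 1)"
    have c: "c > 0" using assms by (simp add: c_def)
    show ?case
    proof (cases "x \<le> \<alpha> ^ N")
      case True
      have pos: "\<alpha> ^ N > 0" using assms by simp
      have le: "1 / \<alpha> ^ N \<le> 1 / x" using True assms by (simp add: frac_le)
      have "1 / \<alpha> ^ Suc N \<le> 1 / \<alpha> ^ N" using assms pos by (simp add: field_simps)
      then have m: "min (1 / x) (1 / \<alpha> ^ Suc N) = 1 / \<alpha> ^ Suc N" using le by simp
      have eq: "1 / \<alpha> ^ N = c * (1 / \<alpha> ^ N - 1 / \<alpha> ^ Suc N)"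
        using assms pos by (simp add: c_def field_simps)
      have "(\<Sum>j<Suc N. if x \<le> \<alpha> ^ j then 1 / \<alpha> ^ j else 0) \<le> c * (1 / x - 1 / \<alpha> ^ N) + 1 / \<alpha> ^ N"
        using Suc True le by (simp add: c_def)
      also have "\<dots> = c * (1 / x - 1 / \<alpha> ^ Suc N)" by (subst (2) eq) (simp add: algebra_simps)
      finally show ?thesis using m by (simp add: c_def)
    next
      case False
      have pos: "\<alpha> ^ N > 0" using assms by simp
      have "1 / x \<le> 1 / \<alpha> ^ N" using False assms pos by (simp add: frac_le)
      then have "(\<Sum>j<Suc N. if x \<le> \<alpha> ^ j then 1 / \<alpha> ^ j else 0) \<le> 0"
        using Suc False by simp
      also have "0 \<le> c * (1 / x - min (1 / x) (1 / \<alpha> ^ Suc N))" using c by simp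
      finally show ?thesis by (simp add: c_def)
    qed
  qed
  also have "\<dots> \<le> \<alpha> / (\<alpha> - 1) * (1 / x)"
    using assms by (intro mult_left_mono) auto
  finally show ?thesis by simp
qed

text \<open>
  Here a first moment becomes sufficient: summed over the geometric indices \<open>k\<close>, the quantities
  \<open>(truncate k x)\<^sup>2 / k\<close> cost only a multiple of \<open>x\<close>, since each nonzero term is \<open>x\<^sup>2 / k\<close> with
  \<open>k \<ge> x\<close>.
\<close>

lemma sum_truncate_square_le:
  assumes "\<alpha> > 1" "x \<ge> 0"
  shows "(\<Sum>j<N. (truncate (geometric_index \<alpha> j) x)\<^sup>2 / real (geometric_index \<alpha> j))
    \<le> 2 * \<alpha> / (\<alpha> - 1) * x"
proof (cases "x = 0")
  case False
  with assms have x: "x > 0" by simp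
  have "(truncate (geometric_index \<alpha> j) x)\<^sup>2 / real (geometric_index \<alpha> j)
      \<le> 2 * x\<^sup>2 * (if x \<le> \<alpha> ^ j then 1 / \<alpha> ^ j else 0)" for j
  proof -
    note b = geometric_index_bounds[OF assms(1), of j]
    have k: "real (geometric_index \<alpha> j) > 0" and p: "\<alpha> ^ j > 0" using b(1) assms by auto
    show ?thesis
    proof (cases "x \<le> real (geometric_index \<alpha> j)")
      case True
      then have le: "x \<le> \<alpha> ^ j" using b(2) by linarith
      have "x\<^sup>2 * (1 / real (geometric_index \<alpha> j)) \<le> x\<^sup>2 * (2 / \<alpha> ^ j)"
        using b(4) k p by (intro mult_left_mono) (auto simp: field_simps)
      then show ?thesis using True le by (simp add: truncate_def mult.commute)
    qed (use p in \<open>simp add: truncate_def\<close>)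
  qed
  then have "(\<Sum>j<N. (truncate (geometric_index \<alpha> j) x)\<^sup>2 / real (geometric_index \<alpha> j))
      \<le> 2 * x\<^sup>2 * (\<Sum>j<N. if x \<le> \<alpha> ^ j then 1 / \<alpha> ^ j else 0)"
    unfolding sum_distrib_left by (rule sum_mono)
  also have "\<dots> \<le> 2 * x\<^sup>2 * (\<alpha> / (\<alpha> - 1) / x)"
    by (intro mult_left_mono sum_inverse_powers_above_le assms x) simp
  also have "\<dots> = 2 * \<alpha> / (\<alpha> - 1) * x" using x by (simp add: power2_eq_square)
  finally show ?thesis .
qed (simp add: truncate_def)

text \<open>
  For \<open>\<alpha> ^ i \<le> n < \<alpha> ^ (i + 1)\<close>, monotonicity compares \<open>S n / n\<close> with the averages at the indices
  belonging to \<open>i\<close> and \<open>i + 1\<close>, up to factors \<open>1 / \<alpha> - 1 / n\<close> and \<open>\<alpha>\<close>. Thus all limit points of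
  \<open>S n / n\<close> lie between \<open>L / \<alpha>\<close> and \<open>\<alpha> * L\<close>, and \<open>\<alpha>\<close> may be taken close to one. Only countably many
  values of \<open>\<alpha>\<close> are demanded, so that the hypothesis can be verified almost surely.
\<close>

lemma averages_converge_from_geometric_indices:
  fixes S :: "nat \<Rightarrow> real"
  assumes mono: "mono S" and nonneg: "\<And>n. S n \<ge> 0"
    and lim: "\<And>m::nat. (\<lambda>j. S (geometric_index (1 + 1 / real (Suc m)) j)
        / real (geometric_index (1 + 1 / real (Suc m)) j)) \<longlonglongrightarrow> L"
  shows "(\<lambda>n. S n / real n) \<longlonglongrightarrow> L"
proof -
  have bounds: "\<forall>\<^sub>F n in sequentially. L / (1 + 1 / real (Suc m)) - e < S n / real n \<and>
      S n / real n < (1 + 1 / real (Suc m)) * L + e" if e: "e > 0" for m e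
  proof -
    define \<alpha> where "\<alpha> = 1 + 1 / real (Suc m)"
    have a: "\<alpha> > 1" by (simp add: \<alpha>_def)
    define k where "k = geometric_index \<alpha>"
    define q where "q j = S (k j) / real (k j)" for j
    have q: "q \<longlonglongrightarrow> L" using lim[of m] by (simp add: q_def[abs_def] k_def \<alpha>_def)
    define i where "i n = nat \<lfloor>log \<alpha> (real n)\<rfloor>" for n
    have "filterlim (\<lambda>x. 1 / ln \<alpha> * ln x) at_top at_top"
      by (rule filterlim_tendsto_pos_mult_at_top[OF tendsto_const _ ln_at_top]) (use a in simp)
    then have log_top: "filterlim (log \<alpha>) at_top at_top" by (simp add: log_def[abs_def])
    have i_top: "filterlim i at_top sequentially"
      unfolding i_def
      by (intro filterlim_compose[OF filterlim_nat_sequentially]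
          filterlim_compose[OF filterlim_floor_sequentially]
          filterlim_compose[OF log_top] filterlim_real_sequentially)
    have i_bounds: "\<alpha> ^ i n \<le> real n" "real n < \<alpha> ^ Suc (i n)" if n: "n \<ge> 1" for n
    proof -
      have l0: "0 \<le> log \<alpha> (real n)" using a n by simp
      have "real (i n) \<le> log \<alpha> (real n)" using l0 unfolding i_def by simp
      then show "\<alpha> ^ i n \<le> real n" using a n by (simp add: le_log_iff powr_realpow)
      have "log \<alpha> (real n) < real (Suc (i n))" using l0 unfolding i_def by simp linarith
      then have "real n < \<alpha> powr real (Suc (i n))" using a n by (subst (asm) log_less_iff) auto
      then show "real n < \<alpha> ^ Suc (i n)" using a by (subst (asm) powr_realpow) auto
    qed
    have upper: "S n / real n \<le> \<alpha> * q (Suc (i n))" if n: "n \<ge> 1" for n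
    proof -
      note g = geometric_index_bounds[OF a, of "Suc (i n)", folded k_def]
      have "real n < real (k (Suc (i n))) + 1" using i_bounds(2)[OF n] g(3) by linarith
      then have "n \<le> k (Suc (i n))" by linarith
      then have "S n \<le> S (k (Suc (i n)))" by (rule monoD[OF mono])
      moreover have "real (k (Suc (i n))) \<le> \<alpha> * real n"
        using g(2) i_bounds(1)[OF n] a by (auto intro: order_trans)
      ultimately have "S n * real (k (Suc (i n))) \<le> S (k (Suc (i n))) * (\<alpha> * real n)"
        using nonneg a by (intro mult_mono) auto
      then show ?thesis using g(1) n by (simp add: q_def field_simps)
    qed
    have lower: "q (i n) * (1 / \<alpha> - 1 / real n) \<le> S n / real n" if n: "n \<ge> 1" for n
    proof -
      note g = geometric_index_bounds[OF a, of "i n", folded k_def]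
      have "k (i n) \<le> n" using g(2) i_bounds(1)[OF n] by linarith
      then have le: "S (k (i n)) \<le> S n" by (rule monoD[OF mono])
      have "real n < \<alpha> * \<alpha> ^ i n" using i_bounds(2)[OF n] by simp
      also have "\<dots> \<le> \<alpha> * (real (k (i n)) + 1)" using g(3) a by (intro mult_left_mono) auto
      finally have "real n / \<alpha> - 1 \<le> real (k (i n))" using a by (simp add: field_simps)
      then have "q (i n) * (real n / \<alpha> - 1) \<le> q (i n) * real (k (i n))"
        using nonneg by (intro mult_left_mono) (auto simp: q_def)
      also have "\<dots> = S (k (i n))" using g(1) by (simp add: q_def)
      finally have "q (i n) * (real n / \<alpha> - 1) \<le> S n" using le by linarith
      moreover have "q (i n) * (1 / \<alpha> - 1 / real n) = q (i n) * (real n / \<alpha> - 1) / real n"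
        using n a by (simp add: field_simps)
      ultimately show ?thesis using n by (simp add: divide_right_mono)
    qed
    have "(\<lambda>n. \<alpha> * q (Suc (i n))) \<longlonglongrightarrow> \<alpha> * L"
      by (intro tendsto_mult tendsto_const filterlim_compose[OF q]
          filterlim_compose[OF filterlim_Suc i_top])
    then have 1: "\<forall>\<^sub>F n in sequentially. \<alpha> * q (Suc (i n)) < \<alpha> * L + e"
      by (rule order_tendstoD) (use e in simp)
    have "(\<lambda>n. q (i n) * (1 / \<alpha> - 1 / real n)) \<longlonglongrightarrow> L * (1 / \<alpha> - 0)"
      by (intro tendsto_mult tendsto_diff tendsto_const filterlim_compose[OF q i_top] lim_1_over_n)
    then have 2: "\<forall>\<^sub>F n in sequentially. q (i n) * (1 / \<alpha> - 1 / real n) > L / \<alpha> - e"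
      by (rule order_tendstoD) (use e in simp)
    show ?thesis unfolding \<alpha>_def[symmetric] using 1 2 eventually_ge_at_top[of 1]
    proof eventually_elim
      case (elim n)
      then show ?case using upper[of n] lower[of n] by linarith
    qed
  qed
  have L: "L \<ge> 0" by (rule LIMSEQ_le_const[OF lim[of 0]]) (auto simp: nonneg)
  show ?thesis
  proof (rule LIMSEQ_I)
    fix e :: real assume e: "e > 0"
    obtain m where m: "real m > 2 * L / e" using reals_Archimedean2 by blast
    have "2 * L < e * real m" using m e by (simp add: field_simps)
    then have small: "L / real (Suc m) < e / 2"
      using e by (simp add: field_simps)
    have "L / (1 + 1 / real (Suc m)) \<ge> L * (1 - 1 / real (Suc m))"
    proof -
      have "(1 - 1 / real (Suc m)) * (1 + 1 / real (Suc m)) \<le> 1" by (simp add: algebra_simps)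
      then have "1 - 1 / real (Suc m) \<le> 1 / (1 + 1 / real (Suc m))" by (subst pos_le_divide_eq) (auto simp: add_pos_nonneg)
      from mult_left_mono[OF this L] show ?thesis by simp
    qed
    then have lo: "L / (1 + 1 / real (Suc m)) \<ge> L - L / real (Suc m)" by (simp add: right_diff_distrib)
    have hi: "(1 + 1 / real (Suc m)) * L = L + L / real (Suc m)" by (simp add: distrib_right)
    have "0 < e / 2" using e by simp
    from bounds[OF this, of m] have "\<forall>\<^sub>F n in sequentially. norm (S n / real n - L) < e"
    proof eventually_elim
      case (elim n)
      then have "S n / real n < L + e" "L - e < S n / real n" using lo small unfolding hi by linarith+
      then show ?case by (simp add: abs_less_iff)
    qed
    then show "\<exists>no. \<forall>n\<ge>no. norm (S n / real n - L) < e"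
      by (simp add: eventually_sequentially)
  qed
qed

section \<open>A strong law for weakly correlated variables\<close>

lemma borel_measurable_truncate [measurable]: "truncate k \<in> borel_measurable borel"
  unfolding truncate_def[abs_def] by measurable

lemma truncate_bounds: "x \<ge> 0 \<Longrightarrow> 0 \<le> truncate k x" "x \<ge> 0 \<Longrightarrow> truncate k x \<le> x"
  "x \<ge> 0 \<Longrightarrow> \<bar>truncate k x\<bar> \<le> real k"
  by (auto simp: truncate_def)

lemma truncate_mono: "k \<le> l \<Longrightarrow> x \<ge> 0 \<Longrightarrow> truncate k x \<le> truncate l x"
  by (auto simp: truncate_def)

lemma sum_distance_weights_le:
  fixes c :: "nat \<Rightarrow> real"
  assumes "summable c" "\<And>m. c m \<ge> 0"
  shows "(\<Sum>l<n. c (if k \<le> l then l - k else k - l)) \<le> 2 * suminf c"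
proof -
  have "(\<Sum>l<n. c (if k \<le> l then l - k else k - l))
      \<le> (\<Sum>l\<in>{..<k} \<union> {k..<k + n}. c (if k \<le> l then l - k else k - l))"
    by (intro sum_mono2) (auto simp: assms)
  also have "\<dots> = (\<Sum>l<k. c (k - l)) + (\<Sum>l=k..<k+n. c (l - k))"
    by (subst sum.union_disjoint) (auto intro!: arg_cong2[where f="(+)"] sum.cong)
  also have "(\<Sum>l<k. c (k - l)) = sum c {1..k}"
    by (rule sum.reindex_bij_witness[of _ "\<lambda>i. k - i" "\<lambda>i. k - i"]) auto
  also have "(\<Sum>l=k..<k+n. c (l - k)) = sum c {..<n}"
    by (rule sum.reindex_bij_witness[of _ "\<lambda>i. k + i" "\<lambda>i. i - k"]) auto
  also have "sum c {1..k} + sum c {..<n} \<le> suminf c + suminf c"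
    by (intro add_mono sum_le_suminf assms) auto
  finally show ?thesis by simp
qed

text \<open>
  After expanding the square, the second moment of \<open>Z k\<close> carries the weights \<open>c\<close> of the distances
  from \<open>k\<close> to all indices on its left and on its right, which add up to at most \<open>2 * suminf c\<close>. It
  appears in this way as the first and as the second argument of the covariance: hence the factor 4.
\<close>

lemma (in prob_space) variance_sum_le_sum_squares:
  fixes Z :: "nat \<Rightarrow> 'a \<Rightarrow> real" and c :: "nat \<Rightarrow> real"
  assumes Z [measurable]: "\<And>k. Z k \<in> borel_measurable M"
    and bounded: "\<And>k \<omega>. \<omega> \<in> space M \<Longrightarrow> \<bar>Z k \<omega>\<bar> \<le> B k"
    and c: "summable c" "\<And>m. c m \<ge> 0"
    and corr: "\<And>k l. k \<le> l \<Longrightarrow> expectation (\<lambda>\<omega>. Z k \<omega> * Z l \<omega>) \<le> expectation (Z k) * expectation (Z l)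
        + c (l - k) * (expectation (\<lambda>\<omega>. (Z k \<omega>)\<^sup>2) + expectation (\<lambda>\<omega>. (Z l \<omega>)\<^sup>2))"
  shows "variance (\<lambda>\<omega>. \<Sum>k<n. Z k \<omega>) \<le> 4 * suminf c * (\<Sum>k<n. expectation (\<lambda>\<omega>. (Z k \<omega>)\<^sup>2))"
proof -
  define d where "d k l = c (if k \<le> l then l - k else k - l)" for k l :: nat
  define a where "a k = expectation (\<lambda>\<omega>. (Z k \<omega>)\<^sup>2)" for k
  have a: "a k \<ge> 0" for k unfolding a_def by simp
  have int [intro, simp]: "integrable M (Z k)" for k
    by (rule integrable_const_bound[where B="B k"]) (auto simp: bounded)
  have int2 [intro, simp]: "integrable M (\<lambda>\<omega>. Z k \<omega> * Z l \<omega>)" for k l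
  proof (rule integrable_const_bound[where B="B k * B l"])
    show "AE \<omega> in M. norm (Z k \<omega> * Z l \<omega>) \<le> B k * B l"
      by (rule AE_I2) (auto simp: abs_mult intro!: mult_mono bounded order_trans[OF abs_ge_zero bounded])
  qed measurable
  have corr': "expectation (\<lambda>\<omega>. Z k \<omega> * Z l \<omega>) - expectation (Z k) * expectation (Z l) \<le> d k l * (a k + a l)" for k l
    using corr[of k l] corr[of l k] by (cases "k \<le> l") (auto simp: d_def a_def mult.commute add.commute)
  have sq: "(\<Sum>k<n. Z k \<omega>)\<^sup>2 = (\<Sum>k<n. \<Sum>l<n. Z k \<omega> * Z l \<omega>)" for \<omega>
    by (simp add: power2_eq_square sum_product)
  have "variance (\<lambda>\<omega>. \<Sum>k<n. Z k \<omega>) = expectation (\<lambda>\<omega>. (\<Sum>k<n. Z k \<omega>)\<^sup>2) - (expectation (\<lambda>\<omega>. \<Sum>k<n. Z k \<omega>))\<^sup>2"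
    by (rule variance_eq) (auto simp: sq)
  also have "\<dots> = (\<Sum>k<n. \<Sum>l<n. expectation (\<lambda>\<omega>. Z k \<omega> * Z l \<omega>) - expectation (Z k) * expectation (Z l))"
    by (simp add: sq power2_eq_square sum_product sum_subtractf)
  also have "\<dots> \<le> (\<Sum>k<n. \<Sum>l<n. d k l * (a k + a l))"
    by (intro sum_mono corr')
  also have "\<dots> = (\<Sum>k<n. \<Sum>l<n. d k l * a k) + (\<Sum>k<n. \<Sum>l<n. d k l * a l)"
    by (simp add: distrib_left sum.distrib)
  also have "(\<Sum>k<n. \<Sum>l<n. d k l * a l) = (\<Sum>k<n. \<Sum>l<n. d k l * a k)"
    by (subst sum.swap) (auto simp: d_def intro!: sum.cong)
  also have "(\<Sum>k<n. \<Sum>l<n. d k l * a k) = (\<Sum>k<n. a k * (\<Sum>l<n. d k l))"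
    by (simp add: sum_distrib_left mult.commute)
  also have "\<dots> \<le> (\<Sum>k<n. a k * (2 * suminf c))"
    unfolding d_def by (intro sum_mono mult_left_mono sum_distance_weights_le c a)
  finally show ?thesis by (simp add: a_def sum_distrib_left sum_distrib_right mult_ac)
qed

text \<open>
  By monotone convergence the series itself has a finite integral, so it converges almost
  everywhere. This serves both as Chebyshev's inequality with Borel and Cantelli and, for
  indicator functions, as the Borel and Cantelli lemma.
\<close>

lemma AE_tendsto_zero_of_summable_integrals:
  fixes f :: "nat \<Rightarrow> 'a \<Rightarrow> real"
  assumes int: "\<And>j. integrable M (f j)" and nonneg: "\<And>j x. f j x \<ge> 0"
    and sum: "summable (\<lambda>j. \<integral>x. f j x \<partial>M)"
  shows "AE x in M. (\<lambda>j. f j x) \<longlonglongrightarrow> 0"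
proof -
  have [measurable]: "f j \<in> borel_measurable M" for j using int by auto
  have "(\<integral>\<^sup>+x. (\<Sum>j. ennreal (f j x)) \<partial>M) = (\<Sum>j. \<integral>\<^sup>+x. ennreal (f j x) \<partial>M)"
    by (rule nn_integral_suminf) measurable
  also have "\<dots> = (\<Sum>j. ennreal (\<integral>x. f j x \<partial>M))"
    by (simp add: nn_integral_eq_integral int nonneg)
  also have "\<dots> \<noteq> \<infinity>"
    using sum by (subst suminf_ennreal2) (auto simp: nonneg)
  finally have "AE x in M. (\<Sum>j. ennreal (f j x)) \<noteq> \<infinity>"
    by (intro nn_integral_PInf_AE) auto
  then show ?thesis
    by eventually_elim (auto intro!: summable_LIMSEQ_zero summable_suminf_not_top simp: nonneg)
qed

lemma sum_indicator_less_le: "x \<ge> 0 \<Longrightarrow> (\<Sum>k<n. if real k < x then 1 else 0) \<le> x + 1"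
proof -
  assume "x \<ge> 0"
  then have "(\<Sum>k<n. if real k < x then 1 else 0) \<le> min (real n) (x + 1)"
    by (induction n) (auto simp: min_def split: if_splits)
  then show ?thesis by simp
qed

lemma filterlim_geometric_index:
  assumes "\<alpha> > 1"
  shows "filterlim (geometric_index \<alpha>) at_top sequentially"
proof -
  have "filterlim (\<lambda>j. \<alpha> ^ j) at_top sequentially"
    using assms by (intro filterlim_at_infinity_imp_filterlim_at_top filterlim_realpow_sequentially_gt1) auto
  then have "filterlim (\<lambda>j. -1 + \<alpha> ^ j) at_top sequentially"
    by (rule filterlim_tendsto_add_at_top[OF tendsto_const])
  then have "filterlim (\<lambda>j. real (geometric_index \<alpha> j)) at_top sequentially"
    by (rule filterlim_at_top_mono[OF _ always_eventually])
      (use geometric_index_bounds(3)[OF assms] in \<open>simp add: less_imp_le algebra_simps\<close>)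
  then show ?thesis by (simp add: filterlim_sequentially_iff_filterlim_real)
qed

text \<open>
  The truncated sums \<open>T\<close> satisfy \<open>Var (T n) \<le> C * n * b n\<close>, where \<open>b n\<close> is the second moment of
  \<open>X 0\<close> truncated at \<open>n\<close>. Along geometric indices \<open>k\<close> the series of \<open>Var (T k) / k\<^sup>2\<close> is
  therefore controlled by the first moment (\<open>sum_truncate_square_le\<close>), so \<open>T k / k\<close> follows its mean,
  which tends to \<open>E (X 0)\<close> by dominated convergence and Cesaro averaging. Truncation changes only
  finitely many terms of almost every realisation, because the probabilities of \<open>X 0 > k\<close> sum to at
  most \<open>E (X 0) + 1\<close>.
\<close>

lemma (in prob_space) strong_law_weakly_correlated:
  fixes X :: "nat \<Rightarrow> 'a \<Rightarrow> real" and c :: "nat \<Rightarrow> real"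
  assumes X [measurable]: "\<And>k. X k \<in> borel_measurable M"
    and nonneg: "\<And>k \<omega>. \<omega> \<in> space M \<Longrightarrow> X k \<omega> \<ge> 0"
    and ident: "\<And>k. distr M borel (X k) = distr M borel (X 0)"
    and int: "integrable M (X 0)"
    and c: "summable c" "\<And>m. c m \<ge> 0"
    and corr: "\<And>k l. k \<le> l \<Longrightarrow> expectation (\<lambda>\<omega>. truncate k (X k \<omega>) * truncate l (X l \<omega>))
      \<le> expectation (\<lambda>\<omega>. truncate k (X k \<omega>)) * expectation (\<lambda>\<omega>. truncate l (X l \<omega>))
        + c (l - k) * (expectation (\<lambda>\<omega>. (truncate k (X k \<omega>))\<^sup>2) + expectation (\<lambda>\<omega>. (truncate l (X l \<omega>))\<^sup>2))"
  shows "AE \<omega> in M. (\<lambda>n. (\<Sum>k<n. X k \<omega>) / real n) \<longlonglongrightarrow> expectation (X 0)"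
proof -
  define Z where "Z k \<omega> = truncate k (X k \<omega>)" for k \<omega>
  have Zm [measurable]: "Z k \<in> borel_measurable M" for k unfolding Z_def by measurable
  have transfer: "expectation (\<lambda>\<omega>. f (X k \<omega>)) = expectation (\<lambda>\<omega>. f (X 0 \<omega>))"
    if [measurable]: "f \<in> borel_measurable borel" for f :: "real \<Rightarrow> real" and k
  proof -
    have "expectation (\<lambda>\<omega>. f (X k \<omega>)) = integral\<^sup>L (distr M borel (X k)) f"
      by (subst integral_distr) auto
    also have "\<dots> = expectation (\<lambda>\<omega>. f (X 0 \<omega>))" unfolding ident[of k]
      by (subst integral_distr) auto
    finally show ?thesis .
  qed
  have Zb: "\<bar>Z k \<omega>\<bar> \<le> real k" if "\<omega> \<in> space M" for k \<omega>
    using nonneg[OF that] by (auto simp: Z_def intro: truncate_bounds)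
  have Z_int [simp, intro]: "integrable M (Z k)" for k
    by (rule integrable_const_bound[where B="real k"]) (auto simp: Zb)
  have trunc_int [simp, intro]: "integrable M (\<lambda>\<omega>. (truncate k (X 0 \<omega>))\<^sup>2)" for k
  proof (rule integrable_const_bound[where B="(real k)\<^sup>2"])
    show "AE \<omega> in M. norm ((truncate k (X 0 \<omega>))\<^sup>2) \<le> (real k)\<^sup>2"
    proof (rule AE_I2)
      fix \<omega> assume "\<omega> \<in> space M"
      from power_mono[OF truncate_bounds(3)[OF nonneg[OF this]] abs_ge_zero, of k 0 2]
      show "norm ((truncate k (X 0 \<omega>))\<^sup>2) \<le> (real k)\<^sup>2" by simp
    qed
  qed measurable
  define b where "b n = expectation (\<lambda>\<omega>. (truncate n (X 0 \<omega>))\<^sup>2)" for n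
  have EZ2: "expectation (\<lambda>\<omega>. (Z k \<omega>)\<^sup>2) = b k" for k
    unfolding Z_def b_def by (rule transfer) measurable
  have b_mono: "b k \<le> b n" if "k \<le> n" for k n
    unfolding b_def
  proof (rule integral_mono)
    fix \<omega> assume "\<omega> \<in> space M"
    then show "(truncate k (X 0 \<omega>))\<^sup>2 \<le> (truncate n (X 0 \<omega>))\<^sup>2"
      using that nonneg by (intro power_mono truncate_mono truncate_bounds) auto
  qed auto
  define T where "T n \<omega> = (\<Sum>k<n. Z k \<omega>)" for n \<omega>
  have Tm [measurable]: "T n \<in> borel_measurable M" for n unfolding T_def by measurable
  have C: "suminf c \<ge> 0" using c by (intro suminf_nonneg) auto
  have corr_Z: "expectation (\<lambda>\<omega>. Z k \<omega> * Z l \<omega>) \<le> expectation (Z k) * expectation (Z l)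
      + c (l - k) * (expectation (\<lambda>\<omega>. (Z k \<omega>)\<^sup>2) + expectation (\<lambda>\<omega>. (Z l \<omega>)\<^sup>2))"
    if "k \<le> l" for k l
    using corr[OF that] by (simp add: Z_def[abs_def])
  have var: "variance (T n) \<le> 4 * suminf c * (real n * b n)" for n
  proof -
    have "variance (T n) \<le> 4 * suminf c * (\<Sum>k<n. b k)"
      using variance_sum_le_sum_squares[OF Zm Zb c corr_Z, of n] unfolding EZ2 T_def[abs_def] .
    also have "(\<Sum>k<n. b k) \<le> (\<Sum>k<n. b n)" by (intro sum_mono b_mono) auto
    finally show ?thesis using C by (auto intro: mult_left_mono order_trans)
  qed
  have Tint [simp, intro]: "integrable M (\<lambda>\<omega>. (T n \<omega> - expectation (T n))\<^sup>2)" for n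
  proof (rule integrable_const_bound[where B="(real (n * n) + \<bar>expectation (T n)\<bar>)\<^sup>2"])
    show "AE \<omega> in M. norm ((T n \<omega> - expectation (T n))\<^sup>2) \<le> (real (n * n) + \<bar>expectation (T n)\<bar>)\<^sup>2"
    proof (rule AE_I2)
      fix \<omega> assume w: "\<omega> \<in> space M"
      have "\<bar>T n \<omega>\<bar> \<le> (\<Sum>k<n. \<bar>Z k \<omega>\<bar>)" unfolding T_def by (rule sum_abs)
      also have "\<dots> \<le> (\<Sum>k<n. real n)" by (rule sum_mono) (use Zb[OF w] in \<open>fastforce intro: order_trans\<close>)
      finally have "\<bar>T n \<omega> - expectation (T n)\<bar> \<le> real (n * n) + \<bar>expectation (T n)\<bar>" by simp
      from power_mono[OF this abs_ge_zero, of 2]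
      show "norm ((T n \<omega> - expectation (T n))\<^sup>2) \<le> (real (n * n) + \<bar>expectation (T n)\<bar>)\<^sup>2" by simp
    qed
  qed measurable
  have along: "AE \<omega> in M. (\<lambda>j. (T (geometric_index \<alpha> j) \<omega> - expectation (T (geometric_index \<alpha> j)))
      / real (geometric_index \<alpha> j)) \<longlonglongrightarrow> 0" if a: "\<alpha> > 1" for \<alpha>
  proof -
    define k where "k = geometric_index \<alpha>"
    have k: "k j > 0" for j using geometric_index_bounds(1)[OF a, of j] by (simp add: k_def)
    define f where "f j \<omega> = ((T (k j) \<omega> - expectation (T (k j))) / real (k j))\<^sup>2" for j \<omega>
    have f_int: "integrable M (f j)" for j unfolding f_def power_divide by auto
    have Ef: "expectation (f j) \<le> 4 * suminf c * (b (k j) / real (k j))" for j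
    proof -
      have "expectation (f j) = variance (T (k j)) / (real (k j))\<^sup>2"
        unfolding f_def power_divide by simp
      also have "\<dots> \<le> 4 * suminf c * (real (k j) * b (k j)) / (real (k j))\<^sup>2"
        by (intro divide_right_mono var) simp
      finally show ?thesis using k[of j] by (simp add: power2_eq_square field_simps)
    qed
    have "summable (\<lambda>j. b (k j) / real (k j))"
    proof (rule summableI_nonneg_bounded)
      show "0 \<le> b (k j) / real (k j)" for j by (simp add: b_def)
      show "(\<Sum>j<N. b (k j) / real (k j)) \<le> 2 * \<alpha> / (\<alpha> - 1) * expectation (X 0)" for N
      proof -
        have "(\<Sum>j<N. b (k j) / real (k j)) = expectation (\<lambda>\<omega>. \<Sum>j<N. (truncate (k j) (X 0 \<omega>))\<^sup>2 / real (k j))"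
          unfolding b_def by simp
        also have "\<dots> \<le> expectation (\<lambda>\<omega>. 2 * \<alpha> / (\<alpha> - 1) * X 0 \<omega>)"
        proof (rule integral_mono)
          fix \<omega> assume "\<omega> \<in> space M"
          then show "(\<Sum>j<N. (truncate (k j) (X 0 \<omega>))\<^sup>2 / real (k j)) \<le> 2 * \<alpha> / (\<alpha> - 1) * X 0 \<omega>"
            unfolding k_def by (intro sum_truncate_square_le a nonneg)
        qed (use int in auto)
        finally show ?thesis by simp
      qed
    qed
    then have "summable (\<lambda>j. 4 * suminf c * (b (k j) / real (k j)))" by (rule summable_mult)
    then have "summable (\<lambda>j. expectation (f j))"
      by (rule summable_comparison_test'[where N=0]) (use Ef in \<open>auto simp: f_def\<close>)
    from AE_tendsto_zero_of_summable_integrals[OF f_int _ this]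
    have "AE \<omega> in M. (\<lambda>j. f j \<omega>) \<longlonglongrightarrow> 0" by (simp add: f_def)
    then show ?thesis
    proof eventually_elim
      case (elim \<omega>)
      from tendsto_real_sqrt[OF this]
      have "(\<lambda>j. \<bar>(T (k j) \<omega> - expectation (T (k j))) / real (k j)\<bar>) \<longlonglongrightarrow> 0"
        unfolding f_def real_sqrt_abs by simp
      then show ?case unfolding tendsto_rabs_zero_iff k_def .
    qed
  qed
  have EZ: "(\<lambda>k. expectation (Z k)) \<longlonglongrightarrow> expectation (X 0)"
  proof -
    have "(\<lambda>k. expectation (\<lambda>\<omega>. truncate k (X 0 \<omega>))) \<longlonglongrightarrow> expectation (X 0)"
    proof (rule integral_dominated_convergence[where w="X 0"])
      show "AE \<omega> in M. (\<lambda>k. truncate k (X 0 \<omega>)) \<longlonglongrightarrow> X 0 \<omega>"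
      proof (rule AE_I2, rule tendsto_eventually)
        fix \<omega>
        obtain N where "X 0 \<omega> \<le> real N" using real_arch_simple by blast
        then show "\<forall>\<^sub>F k in sequentially. truncate k (X 0 \<omega>) = X 0 \<omega>"
          unfolding eventually_sequentially truncate_def by (intro exI[of _ N]) auto
      qed
    qed (use int nonneg truncate_bounds in auto)
    moreover have "expectation (Z k) = expectation (\<lambda>\<omega>. truncate k (X 0 \<omega>))" for k
      unfolding Z_def by (rule transfer) measurable
    ultimately show ?thesis by simp
  qed
  have ET: "(\<lambda>n. expectation (T n) / real n) \<longlonglongrightarrow> expectation (X 0)"
    using cesaro[OF EZ] by (simp add: T_def[abs_def])
  have untruncated: "AE \<omega> in M. (\<lambda>n. (\<Sum>k<n. X k \<omega> - Z k \<omega>) / real n) \<longlonglongrightarrow> 0"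
  proof -
    define A where "A k \<omega> = (if real k < X k \<omega> then 1 else 0 :: real)" for k \<omega>
    have Am [measurable]: "A k \<in> borel_measurable M" for k unfolding A_def by measurable
    have A_int: "integrable M (A k)" for k
      by (rule integrable_const_bound[where B=1]) (auto simp: A_def)
    have A0_int: "integrable M (\<lambda>\<omega>. if real k < X 0 \<omega> then 1 else 0 :: real)" for k
      by (rule integrable_const_bound[where B=1]) auto
    have "summable (\<lambda>k. expectation (A k))"
    proof (rule summableI_nonneg_bounded)
      show "0 \<le> expectation (A k)" for k by (simp add: A_def)
      show "(\<Sum>k<N. expectation (A k)) \<le> expectation (X 0) + 1" for N
      proof -
        have "expectation (A k) = expectation (\<lambda>\<omega>. if real k < X 0 \<omega> then 1 else 0)" for k
          unfolding A_def by (rule transfer) measurable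
        then have "(\<Sum>k<N. expectation (A k)) = expectation (\<lambda>\<omega>. \<Sum>k<N. if real k < X 0 \<omega> then 1 else 0)"
          using A0_int by simp
        also have "\<dots> \<le> expectation (\<lambda>\<omega>. X 0 \<omega> + 1)"
          by (rule integral_mono) (use A0_int int sum_indicator_less_le nonneg in auto)
        finally show ?thesis using int by (simp add: prob_space)
      qed
    qed
    then have "AE \<omega> in M. (\<lambda>k. A k \<omega>) \<longlonglongrightarrow> 0"
      by (rule AE_tendsto_zero_of_summable_integrals[OF A_int, rotated]) (simp add: A_def)
    then show ?thesis
    proof eventually_elim
      case (elim \<omega>)
      then have "\<forall>\<^sub>F k in sequentially. A k \<omega> < 1" by (rule order_tendstoD) simp
      then have "\<forall>\<^sub>F k in sequentially. X k \<omega> - Z k \<omega> = 0"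
        by eventually_elim (auto simp: A_def Z_def truncate_def split: if_splits)
      from cesaro_null[OF tendsto_eventually[OF this]] show ?case .
    qed
  qed
  have "AE \<omega> in M. \<forall>m::nat. (\<lambda>j. (T (geometric_index (1 + 1 / real (Suc m)) j) \<omega>
        - expectation (T (geometric_index (1 + 1 / real (Suc m)) j)))
      / real (geometric_index (1 + 1 / real (Suc m)) j)) \<longlonglongrightarrow> 0"
    unfolding AE_all_countable by (intro allI along) simp
  with untruncated AE_space show ?thesis
  proof eventually_elim
    case (elim \<omega>)
    show ?case
    proof (rule averages_converge_from_geometric_indices)
      show "mono (\<lambda>n. \<Sum>k<n. X k \<omega>)"
        by (intro monoI sum_mono2) (use elim nonneg in auto)
      show "0 \<le> (\<Sum>k<n. X k \<omega>)" for n by (intro sum_nonneg) (use elim nonneg in auto)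
      fix m
      define k where "k = geometric_index (1 + 1 / real (Suc m))"
      have k_top: "filterlim k at_top sequentially"
        unfolding k_def by (rule filterlim_geometric_index) simp
      have "(\<lambda>j. (T (k j) \<omega> - expectation (T (k j))) / real (k j)
          + expectation (T (k j)) / real (k j) + (\<Sum>i<k j. X i \<omega> - Z i \<omega>) / real (k j))
          \<longlonglongrightarrow> 0 + expectation (X 0) + 0"
        by (intro tendsto_add filterlim_compose[OF ET k_top] filterlim_compose[OF elim(1) k_top])
          (use elim(3) in \<open>simp add: k_def del: of_nat_Suc\<close>)
      also have "(\<lambda>j. (T (k j) \<omega> - expectation (T (k j))) / real (k j)
          + expectation (T (k j)) / real (k j) + (\<Sum>i<k j. X i \<omega> - Z i \<omega>) / real (k j))
        = (\<lambda>j. (\<Sum>i<k j. X i \<omega>) / real (k j))"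
        by (simp add: T_def sum_subtractf add_divide_distrib[symmetric])
      finally show "(\<lambda>j. (\<Sum>k<geometric_index (1 + 1 / real (Suc m)) j. X k \<omega>)
          / real (geometric_index (1 + 1 / real (Suc m)) j)) \<longlonglongrightarrow> expectation (X 0)"
        by (simp add: k_def)
    qed
  qed
qed

section \<open>Uniform convergence and the Skorohod metric\<close>

lemma time_changes_id: "id \<in> time_changes m"
  by (auto simp: time_changes_def strict_mono_on_def)

text \<open>
  The identity is an admissible time change, which gives the upper bound. For the lower bound the
  supremum of \<open>\<bar>l t - t\<bar>\<close> has to be one of a bounded set, and it is, because a time change of \<open>[0, m]\<close>
  moves points by at most \<open>m\<close>.
\<close>

lemma skorohod_dist_upto_bounds:
  assumes m: "m \<ge> 0"
  shows "0 \<le> skorohod_dist_upto m x y"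
    and "(\<And>t. t \<in> {0..m} \<Longrightarrow> \<bar>x t - y t\<bar> \<le> e) \<Longrightarrow> skorohod_dist_upto m x y \<le> e"
proof -
  let ?d = "\<lambda>l. max (SUP t\<in>{0..m}. \<bar>l t - t\<bar>) (SUP t\<in>{0..m}. \<bar>x t - y (l t)\<bar>)"
  have nonneg: "0 \<le> ?d l" if "l \<in> time_changes m" for l
  proof -
    have img: "l t \<in> {0..m}" if "t \<in> {0..m}" for t
      using \<open>l \<in> time_changes m\<close> that by (auto simp: time_changes_def)
    have "\<bar>l t - t\<bar> \<le> m" if "t \<in> {0..m}" for t
      using img[OF that] that by auto
    then have "bdd_above ((\<lambda>t. \<bar>l t - t\<bar>) ` {0..m})" by (intro bdd_aboveI2)
    from cSUP_upper[OF _ this, of 0] m have "0 \<le> (SUP t\<in>{0..m}. \<bar>l t - t\<bar>)"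
      by (smt (verit) atLeastAtMost_iff)
    then show ?thesis by simp
  qed
  show "0 \<le> skorohod_dist_upto m x y"
    unfolding skorohod_dist_upto_def
    by (rule cINF_greatest) (use time_changes_id nonneg in auto)
  assume e: "\<And>t. t \<in> {0..m} \<Longrightarrow> \<bar>x t - y t\<bar> \<le> e"
  have "bdd_below (?d ` time_changes m)" using nonneg by (intro bdd_belowI2)
  from cINF_lower[OF this time_changes_id]
  have "skorohod_dist_upto m x y \<le> ?d id" unfolding skorohod_dist_upto_def .
  also have "?d id \<le> e"
  proof (rule max.boundedI)
    have "0 \<le> e" using e[of 0] m by (auto intro: order_trans[OF abs_ge_zero])
    then show "(SUP t\<in>{0..m}. \<bar>id t - t\<bar>) \<le> e" using m by (intro cSUP_least) auto
    show "(SUP t\<in>{0..m}. \<bar>x t - y (id t)\<bar>) \<le> e" using m e by (intro cSUP_least) auto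
  qed
  finally show "skorohod_dist_upto m x y \<le> e" .
qed

lemma abs_taper_diff_le: "\<bar>taper m x t - taper m y t\<bar> \<le> \<bar>x t - y t\<bar>"
proof -
  have "taper m x t - taper m y t
      = (if t \<le> m - 1 then 1 else if t \<le> m then m - t else 0) * (x t - y t)"
    by (simp add: taper_def right_diff_distrib)
  then show ?thesis by (auto simp: abs_mult intro!: mult_left_le_one_le)
qed

text \<open>
  Every summand of the metric tends to zero, since tapering does not increase the uniform
  distance; Tannery's theorem with the weights as majorant handles the sum.
\<close>

lemma skorohod_dist_tendsto_zero:
  assumes unif: "\<And>m. m \<ge> 0 \<Longrightarrow> uniform_limit {0..m} x y sequentially"
  shows "(\<lambda>n. skorohod_dist (x n) y) \<longlonglongrightarrow> 0"
proof -
  define a where "a m n = (1 / 2) ^ Suc m * min 1 (skorohod_dist_upto (real (Suc m))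
      (taper (real (Suc m)) (x n)) (taper (real (Suc m)) y))" for m n
  have bound: "norm (a m n) \<le> (1 / 2) ^ Suc m" for m n
    using skorohod_dist_upto_bounds(1)[of "real (Suc m)"] by (simp add: a_def abs_mult)
  have lim: "(\<lambda>n. a m n) \<longlonglongrightarrow> 0" for m
  proof -
  let ?m = "real (Suc m)"
  let ?d = "\<lambda>n. skorohod_dist_upto ?m (taper ?m (x n)) (taper ?m y)"
  have "?d \<longlonglongrightarrow> 0"
  proof (rule LIMSEQ_I)
    fix e :: real assume e: "e > 0"
    then have "\<forall>\<^sub>F n in sequentially. \<forall>t\<in>{0..?m}. dist (x n t) (y t) < e / 2"
      using unif[of ?m] by (intro uniform_limitD) auto
    then have "\<forall>\<^sub>F n in sequentially. norm (?d n - 0) < e"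
    proof eventually_elim
      case (elim n)
      have "?d n \<le> e / 2"
      proof (rule skorohod_dist_upto_bounds(2))
        fix t assume "t \<in> {0..?m}"
        with elim have "\<bar>x n t - y t\<bar> < e / 2" by (auto simp: dist_real_def)
        then show "\<bar>taper ?m (x n) t - taper ?m y t\<bar> \<le> e / 2"
          using abs_taper_diff_le[of ?m "x n" t y] by linarith
      qed simp
      then show ?case using skorohod_dist_upto_bounds(1)[of ?m "taper ?m (x n)" "taper ?m y"] e by simp
    qed
    then show "\<exists>no. \<forall>n\<ge>no. norm (?d n - 0) < e" by (simp add: eventually_sequentially)
  qed
  from tendsto_mult[OF tendsto_const[of "(1 / 2) ^ Suc m"] tendsto_min[OF tendsto_const[of 1] this]]
  show ?thesis by (simp add: a_def)
  qed
  have summ: "summable (\<lambda>m. (1 / 2 :: real) ^ Suc m)"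
    by (subst summable_Suc_iff) (simp add: summable_geometric)
  have "\<forall>\<^sub>F (m, n) in sequentially \<times>\<^sub>F sequentially. norm (a m n) \<le> (1 / 2) ^ Suc m"
    by (rule always_eventually) (use bound in auto)
  from tannerys_theorem[OF lim this summ] have "(\<lambda>n. \<Sum>m. a m n) \<longlonglongrightarrow> (\<Sum>m. 0)"
    by (simp del: suminf_zero)
  then show ?thesis unfolding skorohod_dist_def a_def by (simp only: suminf_zero)
qed

text \<open>
  Beyond some \<open>T\<close> the quotient \<open>X t / t\<close> is within \<open>d\<close> of its limit, and multiplying by \<open>t \<le> m\<close>
  keeps the error at most \<open>m * d\<close>. The times with \<open>n * t < T\<close> shrink to zero, and there the path and
  the line are both of order \<open>1 / n\<close>.
\<close>

lemma uniform_limit_of_linear_growth: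
  fixes X :: "real \<Rightarrow> real"
  assumes growth: "((\<lambda>t. X t / t) \<longlongrightarrow> \<nu>) at_top"
    and bounded: "\<And>T. \<exists>B. \<forall>t\<in>{0..T}. \<bar>X t\<bar> \<le> B"
  shows "uniform_limit {0..m} (\<lambda>n t. X (real n * t) / real n) (\<lambda>t. \<nu> * t) sequentially"
proof (rule uniform_limitI)
  fix e :: real assume e: "e > 0"
  define d where "d = e / (\<bar>m\<bar> + 1)"
  have d: "d > 0" using e by (simp add: d_def add_nonneg_pos)
  have dm: "\<bar>m\<bar> * d < e" using e by (simp add: d_def field_simps)
  from tendstoD[OF growth d] obtain T0 where T0: "\<And>t. t \<ge> T0 \<Longrightarrow> dist (X t / t) \<nu> < d"
    unfolding eventually_at_top_linorder by blast
  define T where "T = max 1 T0"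
  obtain B where B: "\<And>t. t \<in> {0..T} \<Longrightarrow> \<bar>X t\<bar> \<le> B" using bounded by blast
  obtain N where N: "real N > (B + \<bar>\<nu>\<bar> * T) / e" using reals_Archimedean2 by blast
  have "dist (X (real n * t) / real n) (\<nu> * t) < e" if n: "n > N" and t: "t \<in> {0..m}" for n t
  proof (cases "real n * t \<ge> T")
    case True
    have n0: "real n > 0" using n by simp
    have nt: "real n * t > 0" using True by (simp add: T_def)
    then have t0: "t > 0" using n0 by (simp add: zero_less_mult_iff)
    have "X (real n * t) / real n - \<nu> * t = t * (X (real n * t) / (real n * t) - \<nu>)"
      using n0 t0 by (simp add: field_simps)
    then have "dist (X (real n * t) / real n) (\<nu> * t) = t * dist (X (real n * t) / (real n * t)) \<nu>"
      using t0 by (simp add: dist_real_def abs_mult)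
    also have "\<dots> \<le> \<bar>m\<bar> * d"
      using T0[of "real n * t"] True t t0 d by (intro mult_mono) (auto simp: T_def)
    finally show ?thesis using dm by simp
  next
    case False
    have n0: "real n > 0" using n by simp
    have nt: "0 \<le> real n * t" "real n * t \<le> T" using False t by auto
    have "dist (X (real n * t) / real n) (\<nu> * t) \<le> \<bar>X (real n * t) / real n\<bar> + \<bar>\<nu> * t\<bar>"
      unfolding dist_real_def by (rule abs_triangle_ineq4)
    also have "\<bar>X (real n * t) / real n\<bar> \<le> B / real n"
      using B[of "real n * t"] nt n0 by (simp add: divide_right_mono)
    also have "\<bar>\<nu> * t\<bar> \<le> \<bar>\<nu>\<bar> * T / real n"
    proof -
      have "t \<le> T / real n" using nt n0 by (simp add: field_simps)
      from mult_left_mono[OF this abs_ge_zero[of \<nu>]] show ?thesis using t by (simp add: abs_mult)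
    qed
    also have "B / real n + \<bar>\<nu>\<bar> * T / real n = (B + \<bar>\<nu>\<bar> * T) / real n" by (simp add: add_divide_distrib)
    also have "\<dots> < e"
    proof -
      have "(B + \<bar>\<nu>\<bar> * T) / e < real n" using N n by linarith
      then show ?thesis using n0 e by (simp add: field_simps)
    qed
    finally show ?thesis by simp
  qed
  then show "\<forall>\<^sub>F n in sequentially. \<forall>t\<in>{0..m}. dist (X (real n * t) / real n) (\<nu> * t) < e"
    by (intro eventually_mono[OF eventually_gt_at_top[of N]]) blast
qed

lemma linear_in_skorohod_space: "(\<lambda>t. c * t) \<in> skorohod_space"
  unfolding skorohod_space_def
  by (auto simp: continuous_within intro!: tendsto_intros exI)

section \<open>Inverting the clock along a path\<close>

text \<open>
  Conditions under which the conclusion holds along a single realisation. They hold almost surely,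
  with \<open>v = (\<beta> - 1) / (\<beta> + 1)\<close> and the mean holding time as \<open>\<mu>\<close>, so that probability is confined to
  their verification.
\<close>

locale regular_realisation =
  fixes \<xi> :: "nat \<Rightarrow> int" and \<eta> :: "int \<times> nat \<Rightarrow> real" and v \<mu> :: real
  assumes step_le: "j \<ge> 1 \<Longrightarrow> \<bar>\<xi> j\<bar> \<le> 1"
    and holding_pos: "holding \<xi> \<eta> k > 0"
    and walk_speed: "(\<lambda>n. real_of_int (walk \<xi> n) / real n) \<longlonglongrightarrow> v"
    and clock_speed: "(\<lambda>n. clock \<xi> \<eta> n / real n) \<longlonglongrightarrow> \<mu>"
    and mean_pos: "\<mu> > 0"
begin

abbreviation "S \<equiv> clock \<xi> \<eta>"
abbreviation "N \<equiv> clock_inverse \<xi> \<eta>"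
abbreviation "X \<equiv> trapped_walk \<xi> \<eta>"

lemma clock_0: "S 0 = 0" by (simp add: clock_def)

lemma strict_mono_clock: "strict_mono S"
  by (rule strict_monoI_Suc) (simp add: clock_def holding_pos)

lemma clock_at_top: "filterlim S at_top sequentially"
proof -
  have "filterlim (\<lambda>n. S n / real n * real n) at_top sequentially"
    by (rule filterlim_tendsto_pos_mult_at_top[OF clock_speed mean_pos filterlim_real_sequentially])
  moreover have "S n / real n * real n = S n" for n by (cases "n = 0") (auto simp: clock_0)
  ultimately show ?thesis by simp
qed

text \<open>
  The clock tends to infinity, so the set whose maximum defines the inverse is finite, and it
  contains \<open>0\<close>.
\<close>

lemma clock_inverse_bounds:
  assumes "t \<ge> 0"
  shows "S (N t) \<le> t" "t < S (Suc (N t))"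
proof -
  obtain n where n: "\<And>k. k \<ge> n \<Longrightarrow> S k > t"
    using clock_at_top unfolding filterlim_at_top_dense eventually_sequentially by blast
  have fin: "finite {k. S k \<le> t}"
  proof (rule finite_subset[of _ "{..<n}"])
    show "{k. S k \<le> t} \<subseteq> {..<n}"
    proof
      fix k assume "k \<in> {k. S k \<le> t}"
      then have "\<not> k \<ge> n" using n[of k] by auto
      then show "k \<in> {..<n}" by simp
    qed
  qed simp
  have "0 \<in> {k. S k \<le> t}" using assms by (simp add: clock_0)
  with Max_in[OF fin] show "S (N t) \<le> t" unfolding clock_inverse_def by blast
  show "t < S (Suc (N t))"
  proof (rule ccontr)
    assume "\<not> ?thesis"
    then have "Suc (N t) \<le> Max {k. S k \<le> t}" by (intro Max_ge fin) auto
    then show False by (simp add: clock_inverse_def)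
  qed
qed

lemma clock_inverse_eq:
  assumes "S k \<le> t" "t < S (Suc k)"
  shows "N t = k"
proof -
  have t: "t \<ge> 0" using assms(1) clock_0 strict_mono_less_eq[OF strict_mono_clock, of 0 k] by simp
  note b = clock_inverse_bounds[OF t]
  have "S k < S (Suc (N t))" "S (N t) < S (Suc k)" using b assms by linarith+
  then show ?thesis using strict_mono_less[OF strict_mono_clock] by auto
qed

lemma clock_inverse_mono:
  assumes "0 \<le> s" "s \<le> t"
  shows "N s \<le> N t"
proof -
  have "S (N s) < S (Suc (N t))"
    using clock_inverse_bounds[of s] clock_inverse_bounds[of t] assms by linarith
  then show ?thesis using strict_mono_less[OF strict_mono_clock] by auto
qed

lemma clock_inverse_at_top: "filterlim N at_top at_top"
  unfolding filterlim_at_top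
proof
  fix k
  have "k \<le> N t" if "t \<ge> S k" for t
  proof -
    have "0 \<le> S k" using clock_0 strict_mono_less_eq[OF strict_mono_clock, of 0 k] by simp
    then have "0 \<le> t" using that by simp
    from clock_inverse_bounds(2)[OF this] that have "S k < S (Suc (N t))" by linarith
    then show ?thesis using strict_mono_less[OF strict_mono_clock] by auto
  qed
  then show "\<forall>\<^sub>F t in at_top. k \<le> N t" using eventually_ge_at_top[of "S k"] by (rule eventually_mono[rotated])
qed

lemma eventually_clock_inverse_pos: "\<forall>\<^sub>F t in at_top. N t > 0"
  using eventually_compose_filterlim[OF eventually_gt_at_top clock_inverse_at_top] .

text \<open>
  Sandwiched between \<open>S (N t) / N t\<close> and \<open>S (N t + 1) / N t\<close>, both of which tend to \<open>\<mu>\<close>.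
\<close>

lemma time_per_step: "((\<lambda>t. t / real (N t)) \<longlongrightarrow> \<mu>) at_top"
proof (rule tendsto_sandwich)
  show "((\<lambda>t. S (N t) / real (N t)) \<longlongrightarrow> \<mu>) at_top"
    by (rule filterlim_compose[OF clock_speed clock_inverse_at_top])
  have "(\<lambda>n. (S (Suc n) / real (Suc n)) * (1 + 1 / real n)) \<longlonglongrightarrow> \<mu> * (1 + 0)"
    by (intro tendsto_intros lim_1_over_n LIMSEQ_Suc[OF clock_speed])
  from filterlim_compose[OF this clock_inverse_at_top]
  show "((\<lambda>t. (S (Suc (N t)) / real (Suc (N t))) * (1 + 1 / real (N t))) \<longlongrightarrow> \<mu>) at_top" by simp
  have ev: "\<forall>\<^sub>F t in at_top. t \<ge> 0 \<and> N t > 0"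
    using eventually_ge_at_top[of 0] eventually_clock_inverse_pos
    by eventually_elim simp
  show "\<forall>\<^sub>F t in at_top. S (N t) / real (N t) \<le> t / real (N t)"
    using ev by eventually_elim (simp add: clock_inverse_bounds divide_right_mono)
  show "\<forall>\<^sub>F t in at_top. t / real (N t) \<le> S (Suc (N t)) / real (Suc (N t)) * (1 + 1 / real (N t))"
    using ev
  proof eventually_elim
    case (elim t)
    then have "S (Suc (N t)) / real (Suc (N t)) * (1 + 1 / real (N t)) = S (Suc (N t)) / real (N t)"
      by (simp add: divide_simps)
    moreover have "t / real (N t) \<le> S (Suc (N t)) / real (N t)"
      using clock_inverse_bounds(2)[of t] elim by (intro divide_right_mono) auto
    ultimately show ?case by simp
  qed
qed

lemma trapped_walk_speed: "((\<lambda>t. real_of_int (X t) / t) \<longlongrightarrow> v / \<mu>) at_top"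
proof -
  have "((\<lambda>t. (real_of_int (walk \<xi> (N t)) / real (N t)) / (t / real (N t))) \<longlongrightarrow> v / \<mu>) at_top"
    by (intro tendsto_divide filterlim_compose[OF walk_speed clock_inverse_at_top] time_per_step)
      (use mean_pos in simp)
  moreover have "\<forall>\<^sub>F t in at_top. (real_of_int (walk \<xi> (N t)) / real (N t)) / (t / real (N t)) = real_of_int (X t) / t"
    using eventually_clock_inverse_pos
    by eventually_elim (simp add: trapped_walk_def)
  ultimately show ?thesis by (rule Lim_transform_eventually)
qed

lemma abs_walk_le: "\<bar>walk \<xi> n\<bar> \<le> int n"
proof -
  have "\<bar>walk \<xi> n\<bar> \<le> (\<Sum>j=1..n. \<bar>\<xi> j\<bar>)" unfolding walk_def by (rule sum_abs)
  also have "\<dots> \<le> (\<Sum>j=1..n. 1)" by (rule sum_mono) (simp add: step_le)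
  finally show ?thesis by simp
qed

lemma trapped_walk_bounded: "\<exists>B. \<forall>t\<in>{0..T}. \<bar>real_of_int (X t)\<bar> \<le> B"
proof (intro exI ballI)
  fix t assume "t \<in> {0..T}"
  then have "int (N t) \<le> int (N T)" using clock_inverse_mono by auto
  then have "\<bar>X t\<bar> \<le> int (N T)" using abs_walk_le[of "N t"] unfolding trapped_walk_def by linarith
  then have "real_of_int \<bar>X t\<bar> \<le> real_of_int (int (N T))" by (rule of_int_le_iff[THEN iffD2])
  then show "\<bar>real_of_int (X t)\<bar> \<le> real (N T)" by simp
qed

text \<open>
  The trapped walk is constant on each interval \<open>[S k, S (k + 1))\<close>. Just to the right of a time \<open>t\<close>
  the relevant interval is the one that contains \<open>t\<close>; just to the left it is the one with
  \<open>S j < t \<le> S (j + 1)\<close>, which differs from the former exactly if \<open>t\<close> is a value of the clock.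
\<close>

lemma scaled_trapped_walk_in_skorohod_space:
  fixes a :: real
  assumes "a > 0"
  shows "(\<lambda>t. real_of_int (X (a * t)) / a) \<in> skorohod_space"
proof -
  let ?f = "\<lambda>t. real_of_int (X (a * t)) / a"
  have X_eq: "X s = walk \<xi> k" if "S k \<le> s" "s < S (Suc k)" for s k
    using clock_inverse_eq[OF that] by (simp add: trapped_walk_def)
  have right: "continuous (at_right t) ?f" if "t \<ge> 0" for t
  proof -
    define k where "k = N (a * t)"
    have k: "S k \<le> a * t" "a * t < S (Suc k)"
      unfolding k_def by (rule clock_inverse_bounds, use that assms in simp)+
    have "((\<lambda>s. a * s) \<longlongrightarrow> a * t) (at_right t)" by (intro tendsto_intros)
    from order_tendstoD(2)[OF this k(2)]
    have "\<forall>\<^sub>F s in at_right t. a * s < S (Suc k)" .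
    moreover have "\<forall>\<^sub>F s in at_right t. t < s" by (rule eventually_at_right_less)
    ultimately have "\<forall>\<^sub>F s in at_right t. ?f s = ?f t"
    proof eventually_elim
      case (elim s)
      then have "S k \<le> a * s" using k(1) mult_strict_left_mono[of t s a] assms by linarith
      then show ?case using X_eq[OF k] X_eq[of k "a * s"] elim by simp
    qed
    then show ?thesis unfolding continuous_within by (rule tendsto_eventually)
  qed
  have left: "\<exists>l. (?f \<longlongrightarrow> l) (at_left t)" if t: "t > 0" for t
  proof -
    have at: "a * t > 0" using assms t by simp
    obtain j where j: "S j < a * t" "a * t \<le> S (Suc j)"
    proof (cases "S (N (a * t)) < a * t")
      case True
      then show ?thesis using that clock_inverse_bounds(2)[of "a * t"] at by auto
    next
      case False
      then have eq: "S (N (a * t)) = a * t" using clock_inverse_bounds(1)[of "a * t"] at by simp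
      then have "N (a * t) \<noteq> 0" using at clock_0 assms t by (intro notI) simp
      then obtain j where Nj: "N (a * t) = Suc j" by (cases "N (a * t)") auto
      then show ?thesis using that[of j] eq strict_mono_less[OF strict_mono_clock, of j "Suc j"] by simp
    qed
    have "((\<lambda>s. a * s) \<longlongrightarrow> a * t) (at_left t)" by (intro tendsto_intros)
    from order_tendstoD(1)[OF this j(1)]
    have "\<forall>\<^sub>F s in at_left t. S j < a * s" .
    moreover have "\<forall>\<^sub>F s in at_left t. s < t" by (simp add: eventually_at_filter)
    ultimately have "\<forall>\<^sub>F s in at_left t. ?f s = real_of_int (walk \<xi> j) / a"
    proof eventually_elim
      case (elim s)
      then have "a * s < S (Suc j)" using j(2) mult_strict_left_mono[of s t a] assms by linarith
      then show ?case using X_eq[of j "a * s"] elim by simp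
    qed
    from tendsto_eventually[OF this] show ?thesis by (rule exI)
  qed
  show ?thesis unfolding skorohod_space_def by (simp add: right left)
qed

lemma scaled_trapped_walk_uniform_limit:
  assumes "bounded K" "K \<subseteq> {0..}"
  shows "uniform_limit K (\<lambda>n t. real_of_int (X (real n * t)) / real n) (\<lambda>t. v / \<mu> * t) sequentially"
proof -
  obtain m where m: "\<And>t. t \<in> K \<Longrightarrow> \<bar>t\<bar> \<le> m" using assms(1) by (auto simp: bounded_iff)
  show ?thesis
  proof (rule uniform_limit_on_subset[OF uniform_limit_of_linear_growth[OF trapped_walk_speed trapped_walk_bounded]])
    show "K \<subseteq> {0..m}"
    proof
      fix t assume "t \<in> K"
      then show "t \<in> {0..m}" using m[of t] assms(2) by auto
    qed
  qed
qed

end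

section \<open>Integration over product measures\<close>

text \<open>
  Only finitely many coordinates are involved, so the restriction to them reduces the claim to a
  finite product measure.
\<close>

lemma (in product_prob_space) nn_integral_PiM_prod:
  assumes J: "finite J" "J \<subseteq> I" and f: "\<And>i. i \<in> J \<Longrightarrow> f i \<in> borel_measurable (M i)"
  shows "(\<integral>\<^sup>+x. (\<Prod>i\<in>J. f i (x i)) \<partial>PiM I M) = (\<Prod>i\<in>J. \<integral>\<^sup>+y. f i y \<partial>M i)"
proof -
  have [measurable]: "(\<lambda>x. \<Prod>i\<in>J. f i (x i)) \<in> borel_measurable (PiM J M)"
    by (intro borel_measurable_prod_ennreal measurable_compose[where f="\<lambda>x. x i" for i, OF _ f]) auto
  have "(\<integral>\<^sup>+x. (\<Prod>i\<in>J. f i (x i)) \<partial>PiM I M)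
      = (\<integral>\<^sup>+x. (\<Prod>i\<in>J. f i (restrict x J i)) \<partial>PiM I M)" by simp
  also have "\<dots> = (\<integral>\<^sup>+x. (\<Prod>i\<in>J. f i (x i)) \<partial>distr (PiM I M) (PiM J M) (\<lambda>x. restrict x J))"
    by (subst nn_integral_distr) (auto intro: measurable_restrict_subset[OF J(2)])
  also have "\<dots> = (\<Prod>i\<in>J. \<integral>\<^sup>+y. f i y \<partial>M i)"
    unfolding distr_PiM_restrict_finite[OF J] by (rule product_nn_integral_prod[OF J(1) f])
  finally show ?thesis .
qed

lemma (in product_prob_space) nn_integral_PiM_component:
  assumes "i \<in> I" "f \<in> borel_measurable (M i)"
  shows "(\<integral>\<^sup>+x. f (x i) \<partial>PiM I M) = (\<integral>\<^sup>+y. f y \<partial>M i)"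
  using nn_integral_PiM_prod[of "{i}" "\<lambda>_. f"] assms by simp

lemma (in product_prob_space) nn_integral_PiM_two_components:
  assumes "i \<in> I" "j \<in> I" "i \<noteq> j" "f \<in> borel_measurable (M i)" "g \<in> borel_measurable (M j)"
  shows "(\<integral>\<^sup>+x. f (x i) * g (x j) \<partial>PiM I M) = (\<integral>\<^sup>+y. f y \<partial>M i) * (\<integral>\<^sup>+y. g y \<partial>M j)"
proof -
  have "(\<integral>\<^sup>+x. (\<Prod>k\<in>{i, j}. (if k = i then f else g) (x k)) \<partial>PiM I M)
      = (\<Prod>k\<in>{i, j}. \<integral>\<^sup>+y. (if k = i then f else g) y \<partial>M k)"
    by (rule nn_integral_PiM_prod) (use assms in auto)
  then show ?thesis using assms(3) by simp
qed

lemma AE_pair_fst: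
  assumes "prob_space N" "AE x in M. P x"
  shows "AE z in M \<Otimes>\<^sub>M N. P (fst z)"
  by (rule AE_distrD[of fst _ M]) (use assms(2) in \<open>simp_all only: prob_space.distr_pair_fst[OF assms(1)] measurable_fst\<close>)

section \<open>The annealed law as a product of steps and traps\<close>

definition annealed_trap_law :: "real measure measure \<Rightarrow> (int \<times> nat \<Rightarrow> real) measure" where
  "annealed_trap_law \<pi> = environment_law \<pi> \<bind> trap_law"

text \<open>
  The annealed expectation of \<open>f\<close> of a single holding time.
\<close>

definition site_mean :: "real measure measure \<Rightarrow> (real \<Rightarrow> ennreal) \<Rightarrow> ennreal" where
  "site_mean \<pi> f = (\<integral>\<^sup>+\<nu>. (\<integral>\<^sup>+x. f x \<partial>\<nu>) \<partial>\<pi>)"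

locale trap_model =
  fixes \<pi> :: "real measure measure" and \<beta> :: real
  assumes env: "\<pi> \<in> space (prob_algebra (prob_algebra pos_real))"
    and drift: "\<beta> > 1"
begin

abbreviation "trap_space \<equiv> PiM (UNIV :: (int \<times> nat) set) (\<lambda>_. pos_real)"

lemma sets_env: "sets \<pi> = sets (prob_algebra pos_real)" and prob_env: "prob_space \<pi>"
  using env by (auto simp: space_prob_algebra)

sublocale env: product_prob_space "\<lambda>_. \<pi>" "UNIV :: int set"
  by (simp add: product_prob_space_def product_sigma_finite_def product_prob_space_axioms_def
      prob_env prob_space_imp_sigma_finite)

sublocale step: prob_space "step_law \<beta>" by (rule prob_space_step_law)

lemma annealed_trap_law_in_prob_algebra: "annealed_trap_law \<pi> \<in> space (prob_algebra trap_space)"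
  unfolding annealed_trap_law_def
  using measurable_bind_prob_space[OF measurable_const[OF environment_law_in_prob_algebra[OF env]]
      measurable_trap_law[OF env], of "count_space UNIV"]
  by (auto dest: measurable_space)

lemma sets_annealed_trap_law [measurable_cong]: "sets (annealed_trap_law \<pi>) = sets trap_space"
  and prob_annealed_trap_law: "prob_space (annealed_trap_law \<pi>)"
  using annealed_trap_law_in_prob_algebra by (auto simp: space_prob_algebra)

sublocale trap: prob_space "annealed_trap_law \<pi>" by (rule prob_annealed_trap_law)

lemma measurable_trap_law': "trap_law \<in> environment_law \<pi> \<rightarrow>\<^sub>M subprob_algebra trap_space"
  by (rule measurable_prob_algebraD[OF measurable_trap_law[OF env]])

lemma trap_law_space:
  assumes "\<omega> \<in> space (environment_law \<pi>)"
  shows "prob_space (trap_law \<omega>)" "sets (trap_law \<omega>) = sets trap_space"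
  using measurable_space[OF measurable_trap_law[OF env] assms] by (auto simp: space_prob_algebra)

text \<open>
  The steps do not depend on the environment, so on rectangles the probability of the step event
  factors out of the integral over the environment.
\<close>

lemma annealed_law_eq_product: "annealed_law \<beta> \<pi> = step_law \<beta> \<Otimes>\<^sub>M annealed_trap_law \<pi>"
proof (rule pair_measure_eqI[symmetric])
  show "sigma_finite_measure (step_law \<beta>)" "sigma_finite_measure (annealed_trap_law \<pi>)"
    by unfold_locales
  have "sets (annealed_law \<beta> \<pi>) = sets (step_law \<beta> \<Otimes>\<^sub>M trap_space)"
    unfolding annealed_law_def
    by (rule sets_bind'[OF environment_law_in_prob_algebra[OF env] measurable_quenched_law[OF env]])
  moreover have "sets (step_law \<beta> \<Otimes>\<^sub>M trap_space) = sets (step_law \<beta> \<Otimes>\<^sub>M annealed_trap_law \<pi>)"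
    by (intro sets_pair_measure_cong refl sets_annealed_trap_law[symmetric])
  ultimately show "sets (step_law \<beta> \<Otimes>\<^sub>M annealed_trap_law \<pi>) = sets (annealed_law \<beta> \<pi>)" by simp
  fix B C assume B: "B \<in> sets (step_law \<beta>)" and "C \<in> sets (annealed_trap_law \<pi>)"
  then have C: "C \<in> sets trap_space" by (simp add: sets_annealed_trap_law)
  have quenched: "emeasure (quenched_law \<beta> \<omega>) (B \<times> C) = emeasure (step_law \<beta>) B * emeasure (trap_law \<omega>) C"
    if "\<omega> \<in> space (environment_law \<pi>)" for \<omega>
  proof -
    interpret t: prob_space "trap_law \<omega>" by (rule trap_law_space[OF that])
    show ?thesis unfolding quenched_law_def
      by (rule t.emeasure_pair_measure_Times) (use B C trap_law_space[OF that] in auto)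
  qed
  have "emeasure (annealed_law \<beta> \<pi>) (B \<times> C) = (\<integral>\<^sup>+\<omega>. emeasure (quenched_law \<beta> \<omega>) (B \<times> C) \<partial>environment_law \<pi>)"
    by (rule emeasure_annealed_law[OF env]) (use B C in auto)
  also have "\<dots> = (\<integral>\<^sup>+\<omega>. emeasure (step_law \<beta>) B * emeasure (trap_law \<omega>) C \<partial>environment_law \<pi>)"
    by (intro nn_integral_cong quenched)
  also have "\<dots> = emeasure (step_law \<beta>) B * (\<integral>\<^sup>+\<omega>. emeasure (trap_law \<omega>) C \<partial>environment_law \<pi>)"
    by (rule nn_integral_cmult[OF measurable_emeasure_kernel[OF measurable_trap_law' C]])
  also have "(\<integral>\<^sup>+\<omega>. emeasure (trap_law \<omega>) C \<partial>environment_law \<pi>) = emeasure (annealed_trap_law \<pi>) C"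
    unfolding annealed_trap_law_def
    by (rule emeasure_bind_prob_algebra[OF environment_law_in_prob_algebra[OF env] measurable_trap_law[OF env] C, symmetric])
  finally show "emeasure (step_law \<beta>) B * emeasure (annealed_trap_law \<pi>) C = emeasure (annealed_law \<beta> \<pi>) (B \<times> C)" ..
qed

lemma measurable_coordinate: "(\<lambda>\<eta>. \<eta> z) \<in> borel_measurable trap_space"
proof -
  have "(\<lambda>x :: real. x) \<in> borel_measurable pos_real" unfolding pos_real_def
    by (rule measurable_restrict_space1) simp
  from measurable_compose[where f="\<lambda>\<eta>. \<eta> z", OF _ this] show ?thesis by simp
qed

lemma coordinate_pos: "\<eta> \<in> space trap_space \<Longrightarrow> \<eta> z > 0"
  by (auto simp: space_PiM pos_real_def space_restrict_space)

lemma nn_integral_annealed_trap_law: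
  assumes "F \<in> borel_measurable trap_space"
  shows "(\<integral>\<^sup>+\<eta>. F \<eta> \<partial>annealed_trap_law \<pi>) = (\<integral>\<^sup>+\<omega>. \<integral>\<^sup>+\<eta>. F \<eta> \<partial>trap_law \<omega> \<partial>environment_law \<pi>)"
  unfolding annealed_trap_law_def by (rule nn_integral_bind[OF assms measurable_trap_law'])

lemma measurable_site_integral:
  assumes "f \<in> borel_measurable borel"
  shows "(\<lambda>\<nu>. \<integral>\<^sup>+x. f x \<partial>\<nu>) \<in> borel_measurable \<pi>"
proof -
  have "f \<in> borel_measurable pos_real" unfolding pos_real_def by (rule measurable_restrict_space1[OF assms])
  then have "(\<lambda>\<nu>. \<integral>\<^sup>+x. f x \<partial>\<nu>) \<in> borel_measurable (subprob_algebra pos_real)"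
    by (rule nn_integral_measurable_subprob_algebra)
  then have "(\<lambda>\<nu>. \<integral>\<^sup>+x. f x \<partial>\<nu>) \<in> borel_measurable (prob_algebra pos_real)"
    unfolding prob_algebra_def by (rule measurable_restrict_space1)
  then show ?thesis using measurable_cong_sets[OF sets_env refl] by blast
qed

lemma trap_law_product:
  assumes "\<omega> \<in> space (environment_law \<pi>)"
  shows "product_prob_space (\<lambda>z :: int \<times> nat. \<omega> (fst z))"
    and "f \<in> borel_measurable borel \<Longrightarrow> f \<in> borel_measurable (\<omega> x)"
    and "trap_law \<omega> = PiM UNIV (\<lambda>z. \<omega> (fst z))"
proof -
  have "\<omega> x \<in> space \<pi>" for x using assms by (auto simp: environment_law_def space_PiM)
  then have s: "prob_space (\<omega> x)" "sets (\<omega> x) = sets pos_real" for x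
    using sets_eq_imp_space_eq[OF sets_env] by (auto simp: space_prob_algebra)
  show "product_prob_space (\<lambda>z :: int \<times> nat. \<omega> (fst z))"
    by (simp add: product_prob_space_def product_sigma_finite_def product_prob_space_axioms_def
      s prob_space_imp_sigma_finite)
  show "f \<in> borel_measurable (\<omega> x)" if "f \<in> borel_measurable borel"
    using measurable_restrict_space1[OF that, of "{0<..}"] measurable_cong_sets[OF s(2) refl]
    unfolding pos_real_def by blast
  show "trap_law \<omega> = PiM UNIV (\<lambda>z. \<omega> (fst z))" by (simp add: trap_law_def case_prod_beta')
qed

lemma nn_integral_one_trap:
  assumes f: "f \<in> borel_measurable borel"
  shows "(\<integral>\<^sup>+\<eta>. f (\<eta> z) \<partial>annealed_trap_law \<pi>) = site_mean \<pi> f"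
proof -
  have "(\<integral>\<^sup>+\<eta>. f (\<eta> z) \<partial>annealed_trap_law \<pi>) = (\<integral>\<^sup>+\<omega>. \<integral>\<^sup>+\<eta>. f (\<eta> z) \<partial>trap_law \<omega> \<partial>environment_law \<pi>)"
    by (rule nn_integral_annealed_trap_law) (rule measurable_compose[OF measurable_coordinate f])
  also have "\<dots> = (\<integral>\<^sup>+\<omega>. (\<integral>\<^sup>+x. f x \<partial>\<omega> (fst z)) \<partial>environment_law \<pi>)"
  proof (rule nn_integral_cong)
    fix \<omega> assume w: "\<omega> \<in> space (environment_law \<pi>)"
    interpret t: product_prob_space "\<lambda>z :: int \<times> nat. \<omega> (fst z)" UNIV by (rule trap_law_product[OF w])
    show "(\<integral>\<^sup>+\<eta>. f (\<eta> z) \<partial>trap_law \<omega>) = (\<integral>\<^sup>+x. f x \<partial>\<omega> (fst z))"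
      unfolding trap_law_product(3)[OF w] by (rule t.nn_integral_PiM_component) (use trap_law_product[OF w] f in auto)
  qed
  also have "\<dots> = site_mean \<pi> f"
    unfolding environment_law_def site_mean_def
    by (rule env.nn_integral_PiM_component) (auto intro: measurable_site_integral f)
  finally show ?thesis .
qed

text \<open>
  Traps at different sites are independent also under the annealed law: given the environment the
  two coordinates are independent, and their conditional means depend on the laws at two different
  sites, which are independent in turn. For two visits to one site the second step fails.
\<close>

lemma nn_integral_two_sites:
  assumes f: "f \<in> borel_measurable borel" and g: "g \<in> borel_measurable borel" and "x \<noteq> y"
  shows "(\<integral>\<^sup>+\<eta>. f (\<eta> (x, i)) * g (\<eta> (y, j)) \<partial>annealed_trap_law \<pi>) = site_mean \<pi> f * site_mean \<pi> g"
proof -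
  have "(\<integral>\<^sup>+\<eta>. f (\<eta> (x, i)) * g (\<eta> (y, j)) \<partial>annealed_trap_law \<pi>)
      = (\<integral>\<^sup>+\<omega>. \<integral>\<^sup>+\<eta>. f (\<eta> (x, i)) * g (\<eta> (y, j)) \<partial>trap_law \<omega> \<partial>environment_law \<pi>)"
    by (intro nn_integral_annealed_trap_law borel_measurable_times_ennreal measurable_compose[OF measurable_coordinate f]
        measurable_compose[OF measurable_coordinate g])
  also have "\<dots> = (\<integral>\<^sup>+\<omega>. (\<integral>\<^sup>+t. f t \<partial>\<omega> x) * (\<integral>\<^sup>+t. g t \<partial>\<omega> y) \<partial>environment_law \<pi>)"
  proof (rule nn_integral_cong)
    fix \<omega> assume w: "\<omega> \<in> space (environment_law \<pi>)"
    interpret t: product_prob_space "\<lambda>z :: int \<times> nat. \<omega> (fst z)" UNIV by (rule trap_law_product[OF w])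
    show "(\<integral>\<^sup>+\<eta>. f (\<eta> (x, i)) * g (\<eta> (y, j)) \<partial>trap_law \<omega>) = (\<integral>\<^sup>+t. f t \<partial>\<omega> x) * (\<integral>\<^sup>+t. g t \<partial>\<omega> y)"
      unfolding trap_law_product(3)[OF w]
      using t.nn_integral_PiM_two_components[of "(x, i)" "(y, j)" f g]
        trap_law_product(2)[OF w f] trap_law_product(2)[OF w g] assms(3) by simp
  qed
  also have "\<dots> = site_mean \<pi> f * site_mean \<pi> g"
    unfolding environment_law_def site_mean_def
    by (rule env.nn_integral_PiM_two_components) (use assms in \<open>auto intro: measurable_site_integral\<close>)
  finally show ?thesis .
qed

end

section \<open>Correlations of the holding times\<close>

text \<open>
  The minimum over \<open>s > 0\<close> of the exponential moment \<open>E (s powi (- \<xi> j))\<close> of one step, attained at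
  \<open>s = sqrt \<beta>\<close>.
\<close>

definition return_rate :: "real \<Rightarrow> real" where
  "return_rate \<beta> = 2 * sqrt \<beta> / (\<beta> + 1)"

definition visit :: "(nat \<Rightarrow> int) \<Rightarrow> nat \<Rightarrow> int \<times> nat" where
  "visit \<xi> k = (walk \<xi> k, local_time \<xi> (walk \<xi> k) k)"

lemma holding_eq_visit: "holding \<xi> \<eta> k = \<eta> (visit \<xi> k)"
  by (simp add: holding_def visit_def)

lemma (in finite_measure) integrable_bounded_nonneg:
  fixes f :: "'a \<Rightarrow> real"
  assumes "f \<in> borel_measurable M" "\<And>x. x \<in> space M \<Longrightarrow> 0 \<le> f x" "\<And>x. x \<in> space M \<Longrightarrow> f x \<le> B"
  shows "integrable M f" "(\<integral>\<^sup>+x. ennreal (f x) \<partial>M) = ennreal (\<integral>x. f x \<partial>M)" "0 \<le> (\<integral>x. f x \<partial>M)"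
proof -
  show i: "integrable M f"
    by (rule integrable_const_bound[where B=B]) (use assms in auto)
  show "(\<integral>\<^sup>+x. ennreal (f x) \<partial>M) = ennreal (\<integral>x. f x \<partial>M)"
    by (rule nn_integral_eq_integral[OF i]) (use assms in auto)
  show "0 \<le> (\<integral>x. f x \<partial>M)" by (rule Bochner_Integration.integral_nonneg) (use assms in auto)
qed

text \<open>
  Mixed moments are computed with the nonnegative integral, where Tonelli's theorem applies without
  integrability conditions; this transfers the resulting bound to expectations.
\<close>

lemma (in prob_space) correlation_from_nn_integral:
  fixes X Y :: "'a \<Rightarrow> real"
  assumes X [measurable]: "X \<in> borel_measurable M" and Y [measurable]: "Y \<in> borel_measurable M"
    and bX: "\<And>x. x \<in> space M \<Longrightarrow> 0 \<le> X x \<and> X x \<le> B" and bY: "\<And>x. x \<in> space M \<Longrightarrow> 0 \<le> Y x \<and> Y x \<le> C"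
    and r: "r \<ge> 0"
    and le: "(\<integral>\<^sup>+x. ennreal (X x) * ennreal (Y x) \<partial>M) \<le> (\<integral>\<^sup>+x. ennreal (X x) \<partial>M) * (\<integral>\<^sup>+x. ennreal (Y x) \<partial>M)
      + ennreal r * ((\<integral>\<^sup>+x. ennreal ((X x)\<^sup>2) \<partial>M) + (\<integral>\<^sup>+x. ennreal ((Y x)\<^sup>2) \<partial>M))"
  shows "expectation (\<lambda>x. X x * Y x) \<le> expectation X * expectation Y
      + r * (expectation (\<lambda>x. (X x)\<^sup>2) + expectation (\<lambda>x. (Y x)\<^sup>2))"
proof -
  have iX: "(\<integral>\<^sup>+x. ennreal (X x) \<partial>M) = ennreal (expectation X)" "0 \<le> expectation X"
    using integrable_bounded_nonneg[OF X, of B] bX by auto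
  have iY: "(\<integral>\<^sup>+x. ennreal (Y x) \<partial>M) = ennreal (expectation Y)" "0 \<le> expectation Y"
    using integrable_bounded_nonneg[OF Y, of C] bY by auto
  have iX2: "(\<integral>\<^sup>+x. ennreal ((X x)\<^sup>2) \<partial>M) = ennreal (expectation (\<lambda>x. (X x)\<^sup>2))"
    using bX by (intro integrable_bounded_nonneg(2)[where B="B\<^sup>2"]) (auto intro: power_mono)
  have iY2: "(\<integral>\<^sup>+x. ennreal ((Y x)\<^sup>2) \<partial>M) = ennreal (expectation (\<lambda>x. (Y x)\<^sup>2))"
    using bY by (intro integrable_bounded_nonneg(2)[where B="C\<^sup>2"]) (auto intro: power_mono)
  have "(\<integral>\<^sup>+x. ennreal (X x) * ennreal (Y x) \<partial>M) = (\<integral>\<^sup>+x. ennreal (X x * Y x) \<partial>M)"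
    by (intro nn_integral_cong) (simp add: ennreal_mult bX bY)
  also have "\<dots> = ennreal (expectation (\<lambda>x. X x * Y x))"
    by (rule integrable_bounded_nonneg(2)[where B="B * C"])
      (use bX bY in \<open>auto intro!: mult_mono intro: order_trans\<close>)
  finally show ?thesis
    using le iX(2) iY(2) r unfolding iX(1) iY(1) iX2 iY2
    by (simp add: ennreal_mult[symmetric] ennreal_plus[symmetric] del: ennreal_plus)
qed

context trap_model
begin

abbreviation "P \<equiv> step_law \<beta> \<Otimes>\<^sub>M annealed_trap_law \<pi>"

sublocale joint: pair_prob_space "step_law \<beta>" "annealed_trap_law \<pi>" ..

sublocale steps: product_prob_space "\<lambda>_. measure_pmf (step_pmf \<beta>)" "{1 :: nat..}"
  by (simp add: product_prob_space_def product_sigma_finite_def product_prob_space_axioms_def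
      measure_pmf.sigma_finite_measure_axioms measure_pmf.prob_space_axioms)

lemma measurable_step: "j \<ge> 1 \<Longrightarrow> (\<lambda>\<xi>. \<xi> j) \<in> step_law \<beta> \<rightarrow>\<^sub>M count_space UNIV"
  using measurable_component_singleton[of j "{1..}" "\<lambda>_. measure_pmf (step_pmf \<beta>)"]
  unfolding measurable_cong_sets[OF refl sets_measure_pmf_count_space] step_law_def by simp

lemma measurable_walk [measurable]: "(\<lambda>\<xi>. walk \<xi> k) \<in> step_law \<beta> \<rightarrow>\<^sub>M count_space UNIV"
proof (induction k)
  case (Suc k)
  have "(\<lambda>\<xi>. (\<lambda>y \<xi>. y + \<xi> (Suc k)) (walk \<xi> k) \<xi>) \<in> step_law \<beta> \<rightarrow>\<^sub>M count_space UNIV"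
    by (rule measurable_compose_countable[OF measurable_compose[OF measurable_step] Suc]) auto
  then show ?case by (simp add: walk_def)
qed (simp add: walk_def)

lemma measurable_local_time: "(\<lambda>\<xi>. local_time \<xi> x k) \<in> step_law \<beta> \<rightarrow>\<^sub>M count_space UNIV"
  unfolding local_time_def by (rule measurable_card) measurable

lemma measurable_visit: "(\<lambda>\<xi>. visit \<xi> k) \<in> step_law \<beta> \<rightarrow>\<^sub>M count_space UNIV"
proof -
  have "(\<lambda>\<xi>. (\<lambda>x \<xi>. (x, local_time \<xi> x k)) (walk \<xi> k) \<xi>) \<in> step_law \<beta> \<rightarrow>\<^sub>M count_space UNIV"
    by (rule measurable_compose_countable[OF measurable_compose[OF measurable_local_time] measurable_walk]) auto
  then show ?thesis by (simp add: visit_def)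
qed

lemma measurable_trap_coordinate: "(\<lambda>\<eta>. \<eta> z) \<in> borel_measurable (annealed_trap_law \<pi>)"
  using measurable_coordinate measurable_cong_sets[OF sets_annealed_trap_law refl] by blast

lemma measurable_holding: "(\<lambda>(\<xi>, \<eta>). holding \<xi> \<eta> k) \<in> borel_measurable P"
proof -
  have "(\<lambda>p. (\<lambda>z p. snd p z) (visit (fst p) k) p) \<in> borel_measurable P"
  proof (rule measurable_compose_countable)
    show "(\<lambda>p. snd p z) \<in> borel_measurable P" for z
      by (rule measurable_compose[OF measurable_snd measurable_trap_coordinate])
    show "(\<lambda>p. visit (fst p) k) \<in> P \<rightarrow>\<^sub>M count_space UNIV"
      by (rule measurable_compose[OF measurable_fst measurable_visit])
  qed
  then show ?thesis by (simp add: holding_eq_visit case_prod_beta')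
qed

lemma holding_pos: "p \<in> space P \<Longrightarrow> holding (fst p) (snd p) k > 0"
  unfolding holding_eq_visit
  by (rule coordinate_pos) (auto simp: space_pair_measure sets_eq_imp_space_eq[OF sets_annealed_trap_law])

lemma return_rate_bounds: "0 \<le> return_rate \<beta>" "return_rate \<beta> < 1"
proof -
  show "0 \<le> return_rate \<beta>" using drift by (simp add: return_rate_def)
  have "sqrt \<beta> \<noteq> 1" using drift by simp
  then have "0 < (sqrt \<beta> - 1)\<^sup>2" by simp
  then have "2 * sqrt \<beta> < \<beta> + 1" using drift by (simp add: power2_diff)
  then show "return_rate \<beta> < 1" using drift by (simp add: return_rate_def)
qed

lemma nn_integral_step_pmf:
  "(\<integral>\<^sup>+z. f z \<partial>step_pmf \<beta>) = f (-1) * ennreal (1 / (\<beta> + 1)) + f 1 * ennreal (\<beta> / (\<beta> + 1))"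
proof -
  have "1 - 1 / (\<beta> + 1) = \<beta> / (\<beta> + 1)" using drift by (simp add: field_simps)
  then show ?thesis using drift by (simp add: step_pmf_def)
qed

text \<open>
  On the event in question the steps between \<open>k\<close> and \<open>l\<close> sum to zero, so the product of the weights
  \<open>exp (- ln s * \<xi> j)\<close> equals one there; its expectation factorises over the independent steps.
\<close>

lemma return_probability_le:
  assumes "k \<le> l"
  shows "emeasure (step_law \<beta>) {\<xi> \<in> space (step_law \<beta>). walk \<xi> k = walk \<xi> l} \<le> ennreal (return_rate \<beta> ^ (l - k))"
proof -
  define s where "s = sqrt \<beta>"
  have s: "s > 1" "s * s = \<beta>" using drift by (auto simp: s_def)
  define h :: "int \<Rightarrow> ennreal" where "h z = ennreal (exp (- ln s * of_int z))" for z
  let ?A = "{\<xi> \<in> space (step_law \<beta>). walk \<xi> k = walk \<xi> l}"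
  have "emeasure (step_law \<beta>) ?A = (\<integral>\<^sup>+\<xi>. indicator ?A \<xi> \<partial>step_law \<beta>)"
    by (rule nn_integral_indicator[symmetric]) measurable
  also have "\<dots> \<le> (\<integral>\<^sup>+\<xi>. (\<Prod>j\<in>{k+1..l}. h (\<xi> j)) \<partial>step_law \<beta>)"
  proof (rule nn_integral_mono)
    fix \<xi>
    have "walk \<xi> l = walk \<xi> k + (\<Sum>j=k+1..l. \<xi> j)"
      unfolding walk_def using assms sum.ub_add_nat[of 1 k \<xi> "l - k"] by simp
    then have "(\<Prod>j\<in>{k+1..l}. h (\<xi> j)) = 1" if "walk \<xi> k = walk \<xi> l"
      using that by (simp add: h_def prod_ennreal exp_sum[symmetric] sum_distrib_left[symmetric]
          of_int_sum[symmetric] sum_negf del: of_int_sum)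
    then show "indicator ?A \<xi> \<le> (\<Prod>j\<in>{k+1..l}. h (\<xi> j))" by (auto simp: indicator_def)
  qed
  also have "\<dots> = (\<Prod>j\<in>{k+1..l}. \<integral>\<^sup>+z. h z \<partial>step_pmf \<beta>)"
    unfolding step_law_def by (rule steps.nn_integral_PiM_prod) auto
  also have "(\<integral>\<^sup>+z. h z \<partial>step_pmf \<beta>) = ennreal (return_rate \<beta>)"
  proof -
    have "h (-1) = ennreal s" "h 1 = ennreal (1 / s)"
      using s by (simp_all add: h_def exp_minus inverse_eq_divide)
    moreover have "s * (1 / (\<beta> + 1)) + 1 / s * (\<beta> / (\<beta> + 1)) = return_rate \<beta>"
    proof -
      have "1 / s * \<beta> = s" using s(1) by (simp add: s(2)[symmetric])
      then have "1 / s * (\<beta> / (\<beta> + 1)) = s / (\<beta> + 1)" by simp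
      then show ?thesis by (simp add: return_rate_def s_def)
    qed
    ultimately show ?thesis
      unfolding nn_integral_step_pmf using s drift
      by (simp add: ennreal_mult[symmetric] ennreal_plus[symmetric] del: ennreal_plus)
  qed
  finally show ?thesis using return_rate_bounds by (simp add: ennreal_power)
qed

lemma nn_integral_joint:
  assumes "F \<in> borel_measurable P"
  shows "(\<integral>\<^sup>+p. F p \<partial>P) = (\<integral>\<^sup>+\<xi>. \<integral>\<^sup>+\<eta>. F (\<xi>, \<eta>) \<partial>annealed_trap_law \<pi> \<partial>step_law \<beta>)"
  by (rule trap.nn_integral_fst[symmetric, OF assms])

text \<open>
  For every path the holding time is a single coordinate of the trap array, and all coordinates have
  the same annealed law. In particular the holding times are identically distributed.
\<close>

lemma nn_integral_holding:
  assumes f: "f \<in> borel_measurable borel"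
  shows "(\<integral>\<^sup>+p. f (holding (fst p) (snd p) k) \<partial>P) = site_mean \<pi> f"
proof -
  have "(\<lambda>p. f (holding (fst p) (snd p) k)) \<in> borel_measurable P"
    using measurable_compose[OF measurable_holding f] by (simp add: case_prod_beta')
  then show ?thesis
    by (simp add: nn_integral_joint holding_eq_visit nn_integral_one_trap[OF f] step.emeasure_space_1)
qed

text \<open>
  The path is frozen first. At different sites the mixed moment factorises; at a common site it is at
  most the sum of the second moments, and the probability of a common site is at most
  \<open>return_rate \<beta> ^ (l - k)\<close>.
\<close>

lemma nn_integral_two_holdings_le:
  fixes f g :: "real \<Rightarrow> real"
  assumes f [measurable]: "f \<in> borel_measurable borel" and g [measurable]: "g \<in> borel_measurable borel"
    and "k \<le> l"
  shows "(\<integral>\<^sup>+p. ennreal (f (holding (fst p) (snd p) k)) * ennreal (g (holding (fst p) (snd p) l)) \<partial>P)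
    \<le> site_mean \<pi> f * site_mean \<pi> g
      + ennreal (return_rate \<beta> ^ (l - k)) * (site_mean \<pi> (\<lambda>x. ennreal ((f x)\<^sup>2)) + site_mean \<pi> (\<lambda>x. ennreal ((g x)\<^sup>2)))"
proof -
  define q where "q = site_mean \<pi> (\<lambda>x. ennreal ((f x)\<^sup>2)) + site_mean \<pi> (\<lambda>x. ennreal ((g x)\<^sup>2))"
  let ?A = "{\<xi> \<in> space (step_law \<beta>). walk \<xi> k = walk \<xi> l}"
  note H = measurable_holding[unfolded case_prod_beta', measurable]
  have "(\<integral>\<^sup>+p. ennreal (f (holding (fst p) (snd p) k)) * ennreal (g (holding (fst p) (snd p) l)) \<partial>P)
      = (\<integral>\<^sup>+\<xi>. \<integral>\<^sup>+\<eta>. ennreal (f (\<eta> (visit \<xi> k))) * ennreal (g (\<eta> (visit \<xi> l))) \<partial>annealed_trap_law \<pi> \<partial>step_law \<beta>)"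
    by (subst nn_integral_joint) (auto simp: holding_eq_visit[symmetric])
  also have "\<dots> \<le> (\<integral>\<^sup>+\<xi>. site_mean \<pi> f * site_mean \<pi> g + q * indicator ?A \<xi> \<partial>step_law \<beta>)"
  proof (rule nn_integral_mono)
    fix \<xi> assume \<xi>: "\<xi> \<in> space (step_law \<beta>)"
    show "(\<integral>\<^sup>+\<eta>. ennreal (f (\<eta> (visit \<xi> k))) * ennreal (g (\<eta> (visit \<xi> l))) \<partial>annealed_trap_law \<pi>)
      \<le> site_mean \<pi> f * site_mean \<pi> g + q * indicator ?A \<xi>"
    proof (cases "walk \<xi> k = walk \<xi> l")
      case False
      then show ?thesis using nn_integral_two_sites[of "\<lambda>x. ennreal (f x)" "\<lambda>x. ennreal (g x)" "walk \<xi> k" "walk \<xi> l"]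
        by (simp add: visit_def)
    next
      case True
      have "ennreal a * ennreal b \<le> ennreal (a\<^sup>2) + ennreal (b\<^sup>2)" for a b :: real
      proof (cases "a \<ge> 0 \<and> b \<ge> 0")
        case True
        have "0 \<le> (a - b)\<^sup>2" by simp
        moreover have "0 \<le> a * b" using True by simp
        ultimately have "a * b \<le> a\<^sup>2 + b\<^sup>2" by (simp add: power2_diff)
        then show ?thesis using True by (simp add: ennreal_mult[symmetric] ennreal_plus[symmetric] del: ennreal_plus)
      qed (auto simp: ennreal_neg)
      then have "(\<integral>\<^sup>+\<eta>. ennreal (f (\<eta> (visit \<xi> k))) * ennreal (g (\<eta> (visit \<xi> l))) \<partial>annealed_trap_law \<pi>)
          \<le> (\<integral>\<^sup>+\<eta>. ennreal ((f (\<eta> (visit \<xi> k)))\<^sup>2) + ennreal ((g (\<eta> (visit \<xi> l)))\<^sup>2) \<partial>annealed_trap_law \<pi>)"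
        by (rule nn_integral_mono)
      also have "\<dots> = q"
        unfolding q_def using measurable_trap_coordinate[measurable]
        by (subst nn_integral_add) (auto simp: nn_integral_one_trap[where f="\<lambda>x. ennreal ((f x)\<^sup>2)"]
            nn_integral_one_trap[where f="\<lambda>x. ennreal ((g x)\<^sup>2)"])
      finally show ?thesis using True \<xi> by (auto intro: add_increasing)
    qed
  qed
  also have "\<dots> = site_mean \<pi> f * site_mean \<pi> g + q * emeasure (step_law \<beta>) ?A"
    by (subst nn_integral_add) (auto simp: nn_integral_cmult_indicator step.emeasure_space_1)
  also have "\<dots> \<le> site_mean \<pi> f * site_mean \<pi> g + q * ennreal (return_rate \<beta> ^ (l - k))"
    by (intro add_left_mono mult_left_mono return_probability_le assms) simp
  finally show ?thesis by (simp add: q_def mult.commute)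
qed

lemma holding_averages:
  assumes int: "integrable P (\<lambda>p. holding (fst p) (snd p) 0)"
  shows "AE p in P. (\<lambda>n. clock (fst p) (snd p) n / real n) \<longlonglongrightarrow> (\<integral>p. holding (fst p) (snd p) 0 \<partial>P)"
  unfolding clock_def
proof (rule joint.strong_law_weakly_correlated[where c="\<lambda>m. return_rate \<beta> ^ m"])
  note H = measurable_holding[unfolded case_prod_beta', measurable]
  show "(\<lambda>p. holding (fst p) (snd p) k) \<in> borel_measurable P" for k by measurable
  show "0 \<le> holding (fst p) (snd p) k" if "p \<in> space P" for p k using holding_pos[OF that] by (rule less_imp_le)
  show "integrable P (\<lambda>p. holding (fst p) (snd p) 0)" by (rule int)
  show "distr P borel (\<lambda>p. holding (fst p) (snd p) k) = distr P borel (\<lambda>p. holding (fst p) (snd p) 0)" for k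
  proof (rule measure_eqI)
    fix A assume "A \<in> sets (distr P borel (\<lambda>p. holding (fst p) (snd p) k))"
    then have A [measurable]: "A \<in> sets borel" by simp
    have "emeasure (distr P borel (\<lambda>p. holding (fst p) (snd p) k)) A = site_mean \<pi> (indicator A)" for k
    proof -
      have "emeasure (distr P borel (\<lambda>p. holding (fst p) (snd p) k)) A
          = (\<integral>\<^sup>+x. indicator A x \<partial>distr P borel (\<lambda>p. holding (fst p) (snd p) k))" by simp
      also have "\<dots> = (\<integral>\<^sup>+p. indicator A (holding (fst p) (snd p) k) \<partial>P)"
        by (rule nn_integral_distr) measurable
      also have "\<dots> = site_mean \<pi> (indicator A)" by (rule nn_integral_holding) measurable
      finally show ?thesis .
    qed
    then show "emeasure (distr P borel (\<lambda>p. holding (fst p) (snd p) k)) A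
        = emeasure (distr P borel (\<lambda>p. holding (fst p) (snd p) 0)) A" by simp
  qed simp
  show "summable (\<lambda>m. return_rate \<beta> ^ m)" using return_rate_bounds by (intro summable_geometric) simp
  show "0 \<le> return_rate \<beta> ^ m" for m using return_rate_bounds by simp
  show "joint.expectation (\<lambda>p. truncate k (holding (fst p) (snd p) k) * truncate l (holding (fst p) (snd p) l))
      \<le> joint.expectation (\<lambda>p. truncate k (holding (fst p) (snd p) k)) * joint.expectation (\<lambda>p. truncate l (holding (fst p) (snd p) l))
        + return_rate \<beta> ^ (l - k) * (joint.expectation (\<lambda>p. (truncate k (holding (fst p) (snd p) k))\<^sup>2)
          + joint.expectation (\<lambda>p. (truncate l (holding (fst p) (snd p) l))\<^sup>2))" if "k \<le> l" for k l
  proof (rule joint.correlation_from_nn_integral)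
    fix p assume "p \<in> space P"
    from holding_pos[OF this]
    show "0 \<le> truncate k (holding (fst p) (snd p) k) \<and> truncate k (holding (fst p) (snd p) k) \<le> real k"
      "0 \<le> truncate l (holding (fst p) (snd p) l) \<and> truncate l (holding (fst p) (snd p) l) \<le> real l"
      by (auto simp: truncate_def less_imp_le)
  next
    show "(\<integral>\<^sup>+p. ennreal (truncate k (holding (fst p) (snd p) k)) * ennreal (truncate l (holding (fst p) (snd p) l)) \<partial>P)
      \<le> (\<integral>\<^sup>+p. ennreal (truncate k (holding (fst p) (snd p) k)) \<partial>P) * (\<integral>\<^sup>+p. ennreal (truncate l (holding (fst p) (snd p) l)) \<partial>P)
      + ennreal (return_rate \<beta> ^ (l - k)) * ((\<integral>\<^sup>+p. ennreal ((truncate k (holding (fst p) (snd p) k))\<^sup>2) \<partial>P)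
        + (\<integral>\<^sup>+p. ennreal ((truncate l (holding (fst p) (snd p) l))\<^sup>2) \<partial>P))"
      using nn_integral_two_holdings_le[OF borel_measurable_truncate borel_measurable_truncate that]
        nn_integral_holding[of "\<lambda>x. ennreal (truncate k x)" k] nn_integral_holding[of "\<lambda>x. ennreal (truncate l x)" l]
        nn_integral_holding[of "\<lambda>x. ennreal ((truncate k x)\<^sup>2)" k] nn_integral_holding[of "\<lambda>x. ennreal ((truncate l x)\<^sup>2)" l]
      by simp
  qed (use return_rate_bounds in auto)
qed

section \<open>The speed of the biased walk\<close>

lemma AE_steps: "AE \<xi> in step_law \<beta>. \<forall>j\<ge>1. \<xi> j = -1 \<or> \<xi> j = 1"
proof -
  have pmf: "AE z in step_pmf \<beta>. z = -1 \<or> z = 1"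
    by (auto simp: AE_measure_pmf_iff step_pmf_def)
  have "AE \<xi> in step_law \<beta>. j \<ge> 1 \<longrightarrow> (\<xi> j = -1 \<or> \<xi> j = 1)" for j
  proof (cases "j \<ge> 1")
    case True
    then have "AE \<xi> in step_law \<beta>. \<xi> j = -1 \<or> \<xi> j = 1"
      unfolding step_law_def
      by (intro AE_PiM_component[where P="\<lambda>z. z = -1 \<or> z = 1"] pmf measure_pmf.prob_space_axioms) simp
    then show ?thesis by eventually_elim simp
  qed simp
  then show ?thesis unfolding AE_all_countable by blast
qed

text \<open>
  The strong law is stated for nonnegative variables, so it is applied to the indicators of the
  steps to the right. They are independent, so only the diagonal contributes to the covariances,
  which is expressed by the weights \<open>of_bool (m = 0)\<close>.
\<close>

lemma right_step_averages:
  "AE \<xi> in step_law \<beta>. (\<lambda>n. (\<Sum>k<n. of_bool (\<xi> (Suc k) = 1)) / real n) \<longlonglongrightarrow> \<beta> / (\<beta> + 1)"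
proof -
  define up :: "int \<Rightarrow> real" where "up z = of_bool (z = 1)" for z
  have up [simp]: "0 \<le> up z" for z by (simp add: up_def)
  have one: "(\<integral>\<^sup>+\<xi>. f (\<xi> (Suc k)) \<partial>step_law \<beta>) = (\<integral>\<^sup>+z. f z \<partial>step_pmf \<beta>)" for f :: "int \<Rightarrow> ennreal" and k
    unfolding step_law_def by (rule steps.nn_integral_PiM_component) auto
  have two: "(\<integral>\<^sup>+\<xi>. f (\<xi> (Suc k)) * g (\<xi> (Suc l)) \<partial>step_law \<beta>) = (\<integral>\<^sup>+z. f z \<partial>step_pmf \<beta>) * (\<integral>\<^sup>+z. g z \<partial>step_pmf \<beta>)"
    if "k < l" for f g :: "int \<Rightarrow> ennreal" and k l
    unfolding step_law_def by (rule steps.nn_integral_PiM_two_components) (use that in auto)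
  have meas: "(\<lambda>\<xi>. f (\<xi> (Suc k))) \<in> borel_measurable (step_law \<beta>)" for f :: "int \<Rightarrow> real" and k
    by (rule measurable_compose[OF measurable_step]) auto
  note int = step.integrable_bounded_nonneg[OF meas, where B=1]
  have mean: "step.expectation (\<lambda>\<xi>. up (\<xi> (Suc 0))) = \<beta> / (\<beta> + 1)"
  proof -
    have "ennreal (step.expectation (\<lambda>\<xi>. up (\<xi> (Suc 0)))) = ennreal (\<beta> / (\<beta> + 1))"
      using int(2)[of up 0] one[of "\<lambda>z. ennreal (up z)" 0] nn_integral_step_pmf[of "\<lambda>z. ennreal (up z)"]
      by (simp add: up_def)
    then show ?thesis using int(3)[of up 0] drift by (subst (asm) ennreal_inj) (auto simp: up_def)
  qed
  have "AE \<xi> in step_law \<beta>. (\<lambda>n. (\<Sum>k<n. up (\<xi> (Suc k))) / real n) \<longlonglongrightarrow> step.expectation (\<lambda>\<xi>. up (\<xi> (Suc 0)))"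
  proof (rule step.strong_law_weakly_correlated[where c="\<lambda>m. of_bool (m = 0)"])
    show "integrable (step_law \<beta>) (\<lambda>\<xi>. up (\<xi> (Suc 0)))" by (rule int) (auto simp: up_def)
    show "summable (\<lambda>m. of_bool (m = 0) :: real)" by (rule summable_finite[of "{0}"]) auto
    show "distr (step_law \<beta>) borel (\<lambda>\<xi>. up (\<xi> (Suc k))) = distr (step_law \<beta>) borel (\<lambda>\<xi>. up (\<xi> (Suc 0)))" for k
    proof (rule measure_eqI)
      fix A assume "A \<in> sets (distr (step_law \<beta>) borel (\<lambda>\<xi>. up (\<xi> (Suc k))))"
      then have A [measurable]: "A \<in> sets borel" by simp
      have "emeasure (distr (step_law \<beta>) borel (\<lambda>\<xi>. up (\<xi> (Suc k)))) A = (\<integral>\<^sup>+z. indicator A (up z) \<partial>step_pmf \<beta>)" for k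
      proof -
        have "emeasure (distr (step_law \<beta>) borel (\<lambda>\<xi>. up (\<xi> (Suc k)))) A
            = (\<integral>\<^sup>+x. indicator A x \<partial>distr (step_law \<beta>) borel (\<lambda>\<xi>. up (\<xi> (Suc k))))" by simp
        also have "\<dots> = (\<integral>\<^sup>+\<xi>. indicator A (up (\<xi> (Suc k))) \<partial>step_law \<beta>)"
          by (rule nn_integral_distr[OF meas]) measurable
        also have "\<dots> = (\<integral>\<^sup>+z. indicator A (up z) \<partial>step_pmf \<beta>)" by (rule one)
        finally show ?thesis .
      qed
      then show "emeasure (distr (step_law \<beta>) borel (\<lambda>\<xi>. up (\<xi> (Suc k)))) A
          = emeasure (distr (step_law \<beta>) borel (\<lambda>\<xi>. up (\<xi> (Suc 0)))) A" by simp
    qed simp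
    fix k l :: nat assume "k \<le> l"
    define Z where "Z k \<xi> = truncate k (up (\<xi> (Suc k)))" for k :: nat and \<xi>
    have Zm: "Z k \<in> borel_measurable (step_law \<beta>)" for k unfolding Z_def by (rule meas)
    have Zb: "0 \<le> Z k \<xi> \<and> Z k \<xi> \<le> 1" for k \<xi> by (auto simp: Z_def truncate_def up_def)
    have "step.expectation (\<lambda>\<xi>. Z k \<xi> * Z l \<xi>) \<le> step.expectation (Z k) * step.expectation (Z l)
        + of_bool (l - k = 0) * (step.expectation (\<lambda>\<xi>. (Z k \<xi>)\<^sup>2) + step.expectation (\<lambda>\<xi>. (Z l \<xi>)\<^sup>2))"
    proof (cases "k = l")
      case True
      then show ?thesis using Zb
        by (simp add: power2_eq_square add_increasing integral_nonneg)
    next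
      case False
      with \<open>k \<le> l\<close> have kl: "k < l" by simp
      show ?thesis
      proof (rule step.correlation_from_nn_integral[OF Zm Zm Zb Zb])
        show "(\<integral>\<^sup>+\<xi>. ennreal (Z k \<xi>) * ennreal (Z l \<xi>) \<partial>step_law \<beta>)
            \<le> (\<integral>\<^sup>+\<xi>. ennreal (Z k \<xi>) \<partial>step_law \<beta>) * (\<integral>\<^sup>+\<xi>. ennreal (Z l \<xi>) \<partial>step_law \<beta>)
              + ennreal (of_bool (l - k = 0)) * ((\<integral>\<^sup>+\<xi>. ennreal ((Z k \<xi>)\<^sup>2) \<partial>step_law \<beta>) + (\<integral>\<^sup>+\<xi>. ennreal ((Z l \<xi>)\<^sup>2) \<partial>step_law \<beta>))"
          unfolding Z_def using kl two[OF kl, of "\<lambda>z. ennreal (truncate k (up z))" "\<lambda>z. ennreal (truncate l (up z))"]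
            one[of "\<lambda>z. ennreal (truncate k (up z))" k] one[of "\<lambda>z. ennreal (truncate l (up z))" l] by simp
      qed simp
    qed
    then show "step.expectation (\<lambda>\<xi>. truncate k (up (\<xi> (Suc k))) * truncate l (up (\<xi> (Suc l))))
        \<le> step.expectation (\<lambda>\<xi>. truncate k (up (\<xi> (Suc k)))) * step.expectation (\<lambda>\<xi>. truncate l (up (\<xi> (Suc l))))
          + of_bool (l - k = 0) * (step.expectation (\<lambda>\<xi>. (truncate k (up (\<xi> (Suc k))))\<^sup>2)
            + step.expectation (\<lambda>\<xi>. (truncate l (up (\<xi> (Suc l))))\<^sup>2))"
      unfolding Z_def .
  qed (auto intro: meas)
  then show ?thesis unfolding mean by (simp add: up_def)
qed

text \<open>
  Since all steps are \<open>1\<close> or \<open>-1\<close>, the position at time \<open>n\<close> is twice the number of steps to the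
  right minus \<open>n\<close>.
\<close>

lemma walk_averages:
  "AE \<xi> in step_law \<beta>. (\<lambda>n. real_of_int (walk \<xi> n) / real n) \<longlonglongrightarrow> (\<beta> - 1) / (\<beta> + 1)"
  using right_step_averages AE_steps
proof eventually_elim
  case (elim \<xi>)
  have walk: "real_of_int (walk \<xi> n) = 2 * (\<Sum>k<n. of_bool (\<xi> (Suc k) = 1)) - real n" for n
  proof (induction n)
    case (Suc n)
    have "\<xi> (Suc n) = -1 \<or> \<xi> (Suc n) = 1" using elim(2) by simp
    then show ?case using Suc by (auto simp: walk_def)
  qed (simp add: walk_def)
  have "(\<lambda>n. 2 * ((\<Sum>k<n. of_bool (\<xi> (Suc k) = 1)) / real n) - 1) \<longlonglongrightarrow> 2 * (\<beta> / (\<beta> + 1)) - 1"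
    by (intro tendsto_intros elim(1))
  also have "2 * (\<beta> / (\<beta> + 1)) - 1 = (\<beta> - 1) / (\<beta> + 1)" using drift by (simp add: field_simps)
  finally show ?case
    by (rule Lim_transform_eventually)
      (use eventually_gt_at_top[of 0] in \<open>eventually_elim, simp add: walk field_simps\<close>)
qed

section \<open>Convergence of the trapped walk\<close>

text \<open>
  Holding times are strictly positive, so their mean cannot vanish; this makes the clock run at a
  positive speed, by which the speed of the walk is divided.
\<close>

lemma mean_holding_pos:
  assumes int: "integrable P (\<lambda>p. holding (fst p) (snd p) 0)"
  shows "0 < (\<integral>p. holding (fst p) (snd p) 0 \<partial>P)"
proof -
  have nonneg: "AE p in P. 0 \<le> holding (fst p) (snd p) 0"
    by (rule AE_I2) (use holding_pos less_imp_le in blast)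
  have "(\<integral>p. holding (fst p) (snd p) 0 \<partial>P) \<noteq> 0"
  proof
    assume "(\<integral>p. holding (fst p) (snd p) 0 \<partial>P) = 0"
    then have "AE p in P. holding (fst p) (snd p) 0 = 0"
      using integral_nonneg_eq_0_iff_AE[OF int nonneg] by simp
    then have "AE p in P. False"
      using AE_space
    proof eventually_elim
      case (elim p)
      then show False using holding_pos[of p 0] by simp
    qed
    then show False using joint.AE_False by blast
  qed
  moreover have "0 \<le> (\<integral>p. holding (fst p) (snd p) 0 \<partial>P)" by (rule integral_nonneg_AE[OF nonneg])
  ultimately show ?thesis by simp
qed

lemma AE_regular_realisation:
  assumes int: "integrable P (\<lambda>p. holding (fst p) (snd p) 0)"
  shows "AE p in P. regular_realisation (fst p) (snd p) ((\<beta> - 1) / (\<beta> + 1)) (\<integral>p. holding (fst p) (snd p) 0 \<partial>P)"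
  using holding_averages[OF int] AE_pair_fst[OF prob_annealed_trap_law walk_averages]
    AE_pair_fst[OF prob_annealed_trap_law AE_steps] AE_space
proof eventually_elim
  case (elim p)
  show ?case
  proof
    show "\<bar>fst p j\<bar> \<le> 1" if "j \<ge> 1" for j using elim(3) that by fastforce
  qed (use elim mean_holding_pos[OF int] holding_pos in auto)
qed

end

theorem corollary2p2:
  fixes \<beta> :: real and \<pi> :: "real measure measure"
  assumes "\<pi> \<in> space (prob_algebra (prob_algebra pos_real))"
    and "\<beta> > 1"
    and "integrable (annealed_law \<beta> \<pi>) (\<lambda>(\<xi>, \<eta>). holding \<xi> \<eta> 0)"
  shows "(\<lambda>t. speed \<beta> \<pi> * t) \<in> skorohod_space \<and>
    (AE (\<xi>, \<eta>) in annealed_law \<beta> \<pi>.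
       (\<forall>n::nat. n > 0 \<longrightarrow>
          (\<lambda>t. real_of_int (trapped_walk \<xi> \<eta> (real n * t)) / real n) \<in> skorohod_space) \<and>
       (\<lambda>n::nat. skorohod_dist
          (\<lambda>t. real_of_int (trapped_walk \<xi> \<eta> (real n * t)) / real n)
          (\<lambda>t. speed \<beta> \<pi> * t)) \<longlonglongrightarrow> 0 \<and>
       (\<forall>K. compact K \<and> K \<subseteq> {0..} \<longrightarrow>
          uniform_limit K
            (\<lambda>n t. real_of_int (trapped_walk \<xi> \<eta> (real n * t)) / real n)
            (\<lambda>t. speed \<beta> \<pi> * t) sequentially))"
proof
  interpret trap_model \<pi> \<beta> using assms(1,2) by unfold_locales
  have int: "integrable P (\<lambda>p. holding (fst p) (snd p) 0)"
    using assms(3) by (simp add: annealed_law_eq_product case_prod_beta')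
  define \<mu> where "\<mu> = (\<integral>p. holding (fst p) (snd p) 0 \<partial>P)"
  have speed: "speed \<beta> \<pi> = (\<beta> - 1) / (\<beta> + 1) / \<mu>"
    by (simp add: speed_def annealed_law_eq_product case_prod_beta' \<mu>_def mult.commute)
  show "(\<lambda>t. speed \<beta> \<pi> * t) \<in> skorohod_space" by (rule linear_in_skorohod_space)
  show "AE (\<xi>, \<eta>) in annealed_law \<beta> \<pi>.
       (\<forall>n::nat. n > 0 \<longrightarrow>
          (\<lambda>t. real_of_int (trapped_walk \<xi> \<eta> (real n * t)) / real n) \<in> skorohod_space) \<and>
       (\<lambda>n::nat. skorohod_dist
          (\<lambda>t. real_of_int (trapped_walk \<xi> \<eta> (real n * t)) / real n)
          (\<lambda>t. speed \<beta> \<pi> * t)) \<longlonglongrightarrow> 0 \<and>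
       (\<forall>K. compact K \<and> K \<subseteq> {0..} \<longrightarrow>
          uniform_limit K
            (\<lambda>n t. real_of_int (trapped_walk \<xi> \<eta> (real n * t)) / real n)
            (\<lambda>t. speed \<beta> \<pi> * t) sequentially)"
    unfolding annealed_law_eq_product speed using AE_regular_realisation[OF int, folded \<mu>_def]
  proof eventually_elim
    case (elim p)
    obtain \<xi> \<eta> where p: "p = (\<xi>, \<eta>)" by (cases p)
    interpret regular_realisation \<xi> \<eta> "(\<beta> - 1) / (\<beta> + 1)" \<mu> using elim by (simp add: p)
    show ?case unfolding p prod.case
    proof (intro conjI allI impI)
      show "(\<lambda>t. real_of_int (trapped_walk \<xi> \<eta> (real n * t)) / real n) \<in> skorohod_space"
        if "n > 0" for n :: nat
        using that by (intro scaled_trapped_walk_in_skorohod_space) simp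
      show "(\<lambda>n. skorohod_dist (\<lambda>t. real_of_int (trapped_walk \<xi> \<eta> (real n * t)) / real n)
          (\<lambda>t. (\<beta> - 1) / (\<beta> + 1) / \<mu> * t)) \<longlonglongrightarrow> 0"
        by (intro skorohod_dist_tendsto_zero scaled_trapped_walk_uniform_limit) auto
      show "uniform_limit K (\<lambda>n t. real_of_int (trapped_walk \<xi> \<eta> (real n * t)) / real n)
          (\<lambda>t. (\<beta> - 1) / (\<beta> + 1) / \<mu> * t) sequentially" if "compact K \<and> K \<subseteq> {0..}" for K
        using that by (intro scaled_trapped_walk_uniform_limit compact_imp_bounded) auto
    qed
  qed
qed

end
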